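(* Let $n \geq 3$, and let $\bar X$ be a vertex of the elliptope $\mathcal{E}_n$. Then the property "strict complementarity holds for the MaxCut SDP with objective matrix $-C$ and its dual", regarded as a property of $C$, fails generically on the relative boundary $\mathrm{rbd}\big(\mathbb{S}^n_+ \cap \{\bar X\}^{\perp}\big)$.
   Context: $\mathbb{S}^n$ is the space of symmetric real $n\times n$ matrices with the trace inner product $\langle A,B\rangle = \mathrm{Tr}(AB)$ and the induced norm; $\mathbb{S}^n_+$ is the cone of positive semidefinite matrices; $\{\bar X\}^{\perp} = \{Y \in \mathbb{S}^n : \mathrm{Tr}(Y\bar X) = 0\}$. The elliptope is $\mathcal{E}_n := \{X \in \mathbb{S}^n_+ : \mathrm{diag}(X) = \mathbf{1}\}$, where $\mathrm{diag}$ extracts the diagonal and $\mathbf{1}$ is the all-ones vector. The normal cone of a convex set $\mathscr{C}$ in a Euclidean space at $\bar x \in \mathscr{C}$ is $\{a : \langle a,x\rangle \le \langle a,\bar x\rangle\ \forall x \in \mathscr{C}\}$; $\bar x$ is a vertex of $\mathscr{C}$ if this normal cone is full-dimensional. For a convex set $\mathscr{C}$, $\mathrm{rbd}(\mathscr{C}) := \mathrm{cl}(\mathscr{C}) \setminus \mathrm{ri}(\mathscr{C})$, closure minus relative interior. For an objective matrix $D \in \mathbb{S}^n$, the MaxCut SDP is $\max\{\mathrm{Tr}(DX) : X \in \mathcal{E}_n\}$ and its dual is $\min\{\mathbf{1}^{\top}y : S = \mathrm{Diag}(y) - D,\ S \succeq 0\}$ over $y\in\mathbb{R}^n$, $S \in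 \mathbb{S}^n$, where $\mathrm{Diag}(y)$ is the diagonal matrix with diagonal $y$. Strict complementarity holds for this pair if there is a pair $(X,(y,S))$ of primal-dual optimal solutions with $XS=0$ and $X+S$ positive definite; otherwise it fails. Hausdorff measure: for a finite-dimensional normed space $\mathscr{V}$, $d \ge 0$ real, $\varepsilon>0$ and $\mathscr{X} \subseteq \mathscr{V}$, let $H_d^{\varepsilon}(\mathscr{X})$ be the infimum of $\sum_{i=0}^{\infty} [\mathrm{diam}(\mathscr{U}_i)]^d$ over all countable covers $\{\mathscr{U}_i\}_{i\in\mathbb{N}}$ of $\mathscr{X}$ by subsets of $\mathscr{V}$ with $\mathrm{diam}(\mathscr{U}_i) < \varepsilon$ for all $i$, and $H_d(\mathscr{X}) := \sup_{\varepsilon>0} H_d^{\varepsilon}(\mathscr{X})$ (with the usual convention making $H_0$ the cardinality). The Hausdorff dimension is $\dim_H(\mathscr{X}) := \inf\{d \ge 0 : H_d(\mathscr{X}) = 0\}$. A property $P$ of points of $\mathscr{X}$ holds generically on $\mathscr{X}$ if $H_d(\{x \in \mathscr{X} : P(x) \text{ is false}\}) = 0$ for $d := \dim_H(\mathscr{X})$; $P$ fails generically on $\mathscr{X}$ if the negation of $P$ holds generically on $\mathscr{X}$. *)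

theory Defs
  imports "HOL-Analysis.Analysis"
begin

section \<open>Symmetric matrices and the elliptope\<close>

definition sym_matrices :: "(real^'n^'n) set" where
  "sym_matrices = {A. transpose A = A}"

text \<open>The library inner product on \<^typ>\<open>real^'n^'n\<close> is the entrywise one. On symmetric
  matrices it is the trace inner product, so the library norm is the norm induced by it.\<close>

lemma inner_eq_trace:
  fixes A B :: "real^'n^'n"
  assumes "A \<in> sym_matrices"
  shows "A \<bullet> B = trace (A ** B)"
proof -
  have "A $ i $ j = A $ j $ i" for i j
    using assms by (metis (mono_tags) sym_matrices_def mem_Collect_eq transpose_def vec_lambda_beta)
  then have "A \<bullet> B = (\<Sum>i\<in>UNIV. \<Sum>j\<in>UNIV. A $ j $ i * B $ i $ j)"
    by (simp add: inner_vec_def)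
  also have "\<dots> = trace (A ** B)"
    unfolding trace_def matrix_matrix_mult_def by (simp, rule sum.swap)
  finally show ?thesis .
qed

definition psd_matrices :: "(real^'n^'n) set" where
  "psd_matrices = {A \<in> sym_matrices. \<forall>x. 0 \<le> x \<bullet> (A *v x)}"

definition pos_def_matrices :: "(real^'n^'n) set" where
  "pos_def_matrices = {A \<in> sym_matrices. \<forall>x. x \<noteq> 0 \<longrightarrow> 0 < x \<bullet> (A *v x)}"

definition diag :: "real^'n^'n \<Rightarrow> real^'n" where
  "diag A = (\<chi> i. A $ i $ i)"

definition Diag :: "real^'n \<Rightarrow> real^'n^'n" where
  "Diag y = (\<chi> i j. if i = j then y $ i else 0)"

text \<open>Here \<^term>\<open>1 :: real^'n\<close> is the all-ones vector.\<close>

definition elliptope :: "(real^'n^'n) set" where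
  "elliptope = {X \<in> psd_matrices. diag X = 1}"

definition trace_perp :: "real^'n^'n \<Rightarrow> (real^'n^'n) set" where
  "trace_perp X = {Y \<in> sym_matrices. trace (Y ** X) = 0}"


section \<open>Normal cones and vertices\<close>

text \<open>The Euclidean space is a subspace \<^term>\<open>V\<close> of the ambient type, so normal vectors are taken
  in \<^term>\<open>V\<close> and full-dimensionality is relative to \<^term>\<open>V\<close>.\<close>

definition normal_cone :: "'a::euclidean_space set \<Rightarrow> 'a set \<Rightarrow> 'a \<Rightarrow> 'a set" where
  "normal_cone V K x = {a \<in> V. \<forall>z\<in>K. a \<bullet> z \<le> a \<bullet> x}"

definition is_vertex :: "'a::euclidean_space set \<Rightarrow> 'a set \<Rightarrow> 'a \<Rightarrow> bool" where
  "is_vertex V K x \<longleftrightarrow> x \<in> K \<and> aff_dim (normal_cone V K x) = aff_dim V"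


section \<open>The MaxCut SDP and strict complementarity\<close>

definition primal_optimal :: "real^'n^'n \<Rightarrow> real^'n^'n \<Rightarrow> bool" where
  "primal_optimal D = is_arg_max (\<lambda>X. trace (D ** X)) (\<lambda>X. X \<in> elliptope)"

definition dual_optimal :: "real^'n^'n \<Rightarrow> (real^'n) \<times> (real^'n^'n) \<Rightarrow> bool" where
  "dual_optimal D =
     is_arg_min (\<lambda>(y, S). 1 \<bullet> y) (\<lambda>(y, S). S = Diag y - D \<and> S \<in> psd_matrices)"

definition strict_complementarity :: "real^'n^'n \<Rightarrow> bool" where
  "strict_complementarity D \<longleftrightarrow>
     (\<exists>X y S. primal_optimal D X \<and> dual_optimal D (y, S) \<and>
        X ** S = 0 \<and> X + S \<in> pos_def_matrices)"


section \<open>Hausdorff measure, Hausdorff dimension and genericity\<close>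

text \<open>The empty set contributes \<open>0\<close> and, for \<open>d = 0\<close>, every nonempty set contributes \<open>1\<close>, so that
  the zero-dimensional measure is the cardinality (whereas \<open>0 powr 0 = 0\<close> in the library).\<close>

definition diam_power :: "real \<Rightarrow> 'a::metric_space set \<Rightarrow> ennreal" where
  "diam_power d U =
     (if U = {} then 0 else if d = 0 then 1 else ennreal (diameter U powr d))"

text \<open>Boundedness is required because \<^const>\<open>diameter\<close> is meaningless on unbounded sets.\<close>

definition hausdorff_covers ::
    "'a::metric_space set \<Rightarrow> real \<Rightarrow> 'a set \<Rightarrow> (nat \<Rightarrow> 'a set) set" where
  "hausdorff_covers V \<epsilon> X =
     {U. (\<forall>i. U i \<subseteq> V \<and> bounded (U i) \<and> diameter (U i) < \<epsilon>) \<and> X \<subseteq> (\<Union>i. U i)}"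

definition hausdorff_pre ::
    "'a::metric_space set \<Rightarrow> real \<Rightarrow> real \<Rightarrow> 'a set \<Rightarrow> ennreal" where
  "hausdorff_pre V d \<epsilon> X = (INF U\<in>hausdorff_covers V \<epsilon> X. \<Sum>i. diam_power d (U i))"

definition hausdorff_measure ::
    "'a::metric_space set \<Rightarrow> real \<Rightarrow> 'a set \<Rightarrow> ennreal" where
  "hausdorff_measure V d X = (SUP \<epsilon>\<in>{0<..}. hausdorff_pre V d \<epsilon> X)"

text \<open>For \<^term>\<open>X \<subseteq> V\<close> in a Euclidean space the infimum is over a nonempty set of reals,
  as the measure vanishes for every \<open>d\<close> exceeding the dimension.\<close>

definition hausdorff_dim :: "'a::euclidean_space set \<Rightarrow> 'a set \<Rightarrow> real" where
  "hausdorff_dim V X = Inf {d. 0 \<le> d \<and> hausdorff_measure V d X = 0}"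

definition holds_generically ::
    "'a::euclidean_space set \<Rightarrow> 'a set \<Rightarrow> ('a \<Rightarrow> bool) \<Rightarrow> bool" where
  "holds_generically V X P \<longleftrightarrow>
     hausdorff_measure V (hausdorff_dim V X) {x \<in> X. \<not> P x} = 0"

definition fails_generically ::
    "'a::euclidean_space set \<Rightarrow> 'a set \<Rightarrow> ('a \<Rightarrow> bool) \<Rightarrow> bool" where
  "fails_generically V X P \<longleftrightarrow> holds_generically V X (\<lambda>x. \<not> P x)"

end

theory Submission
  imports Defs
begin

text \<open>A vertex of the elliptope has the form \<open>x x\<^sup>T\<close> with \<open>x \<in> {-1, 1}\<^sup>n\<close>, and the face is the cone of
  positive semidefinite \<open>C\<close> with \<open>C x = 0\<close>; its relative frontier consists of the \<open>C\<close> whose kernel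
  also contains a nonzero vector orthogonal to \<open>x\<close>. For such \<open>C\<close> the dual optimum is attained only at \<open>S = C\<close>,
  so strict complementarity yields an \<open>X\<close> in the elliptope whose range is the kernel of \<open>C\<close>.
  If that kernel is spanned by \<open>x\<close> and \<open>z\<close>, then \<open>diag X = 1\<close> says that all \<open>x\<^sub>i z\<^sub>i\<close> are roots of one
  quadratic polynomial, so the restriction of \<open>x\<close> to a proper nonempty index set lies in the kernel.
  If the kernel is larger, it contains a vector orthogonal to \<open>x\<close> and to any prescribed \<open>e\<close>. Both conditions confine \<open>C\<close> to
  finitely many locally Lipschitz images of linear spaces of codimension 2 in \<open>{C. C x = 0}\<close>, whereas
  the relative frontier projects along a positive semidefinite direction onto a hyperplane of that space
  and therefore has Hausdorff dimension at least that of the hyperplane.\<close>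

section \<open>Null sets of the Hausdorff measure\<close>

text \<open>A supremum in \<open>ennreal\<close> vanishes iff all its terms do, and an infimum
  vanishes iff it lies below every positive bound. The lemmas on null sets work with this cover
  form.\<close>

lemma hausdorff_measure_eq_0_iff:
  "hausdorff_measure V d X = 0 \<longleftrightarrow>
     (\<forall>\<epsilon>>0. \<forall>\<eta>>0. \<exists>U\<in>hausdorff_covers V \<epsilon> X. (\<Sum>i. diam_power d (U i)) < \<eta>)"
proof -
  have "hausdorff_measure V d X = 0 \<longleftrightarrow> (\<forall>\<epsilon>>0. hausdorff_pre V d \<epsilon> X \<le> 0)"
    unfolding hausdorff_measure_def by (auto simp: bot_ennreal[symmetric] SUP_bot_conv bot_unique)
  also have "\<dots> \<longleftrightarrow> (\<forall>\<epsilon>>0. \<forall>\<eta>>0. hausdorff_pre V d \<epsilon> X < \<eta>)"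
    by (metis le_less_trans less_irrefl not_le)
  finally show ?thesis
    unfolding hausdorff_pre_def INF_less_iff .
qed

lemma hausdorff_covers_subset:
  assumes "U \<in> hausdorff_covers V \<epsilon> X" "Y \<subseteq> X"
  shows "U \<in> hausdorff_covers V \<epsilon> Y"
  using assms by (auto simp: hausdorff_covers_def)

lemma hausdorff_measure_0_subset:
  assumes "hausdorff_measure V d X = 0" "Y \<subseteq> X"
  shows "hausdorff_measure V d Y = 0"
  using assms hausdorff_covers_subset unfolding hausdorff_measure_eq_0_iff by metis

lemma hausdorff_covers_mono:
  assumes "U \<in> hausdorff_covers V \<epsilon> X" "\<epsilon> \<le> \<epsilon>'"
  shows "U \<in> hausdorff_covers V \<epsilon>' X"
  using assms by (auto simp: hausdorff_covers_def intro: less_le_trans)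

lemma diameter_mult_le:
  fixes f :: "'a::metric_space \<Rightarrow> 'b::metric_space"
  assumes "bounded U" "K \<ge> 0" "\<And>u v. u \<in> U \<Longrightarrow> v \<in> U \<Longrightarrow> dist (f u) (f v) \<le> K * dist u v"
  shows "bounded (f ` U)" "diameter (f ` U) \<le> K * diameter U"
proof -
  have *: "dist (f u) (f v) \<le> K * diameter U" if "u \<in> U" "v \<in> U" for u v
    using assms(3)[OF that] mult_left_mono[OF diameter_bounded_bound[OF assms(1) that] assms(2)] by linarith
  then show "bounded (f ` U)"
    unfolding bounded_two_points by blast
  show "diameter (f ` U) \<le> K * diameter U"
  proof (cases "U = {}")
    case False
    then show ?thesis unfolding diameter_def[of "f ` U"]
      by (simp, intro cSUP_least) (auto intro: *)
  qed (auto simp: diameter_def)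
qed

lemma diam_power_anti_mono:
  assumes "bounded U" "diameter U \<le> 1" "0 \<le> s" "s \<le> t"
  shows "diam_power t U \<le> diam_power s U"
proof -
  have 0: "0 \<le> diameter U" by (simp add: assms diameter_ge_0)
  have "diameter U powr t \<le> diameter U powr s"
    using assms 0 by (cases "diameter U = 0") (auto intro!: powr_mono')
  \<comment> \<open>This settles \<open>s = 0 < t\<close>, where a nonempty set contributes 1
    instead of a power of its diameter.\<close>
  moreover have "diameter U powr t \<le> 1"
    using assms 0 by (auto intro!: powr_le1)
  ultimately show ?thesis using assms by (auto simp: diam_power_def ennreal_leI)
qed

lemma hausdorff_measure_0_mono:
  assumes "hausdorff_measure V s X = 0" "0 \<le> s" "s \<le> t"
  shows "hausdorff_measure V t X = 0"
  unfolding hausdorff_measure_eq_0_iff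
proof (intro allI impI)
  fix \<epsilon> :: real and \<eta> :: ennreal assume "\<epsilon> > 0" "\<eta> > 0"
  \<comment> \<open>Covers of scale at most 1 suffice, and for diameters below 1 raising the
    exponent lowers every term.\<close>
  moreover have "min \<epsilon> 1 > 0" using \<open>\<epsilon> > 0\<close> by simp
  ultimately obtain U where U: "U \<in> hausdorff_covers V (min \<epsilon> 1) X" "(\<Sum>i. diam_power s (U i)) < \<eta>"
    using assms(1) unfolding hausdorff_measure_eq_0_iff by metis
  have "diam_power t (U i) \<le> diam_power s (U i)" for i
    using U(1) assms by (intro diam_power_anti_mono) (auto simp: hausdorff_covers_def less_imp_le)
  then have "(\<Sum>i. diam_power t (U i)) \<le> (\<Sum>i. diam_power s (U i))"
    by (intro suminf_le) auto
  then have "(\<Sum>i. diam_power t (U i)) < \<eta>" using U(2) by (rule le_less_trans)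
  then show "\<exists>U\<in>hausdorff_covers V \<epsilon> X. (\<Sum>i. diam_power t (U i)) < \<eta>"
    using hausdorff_covers_mono[OF U(1), of \<epsilon>] by auto
qed

lemma hausdorff_measure_0_UN_nat:
  fixes X :: "nat \<Rightarrow> 'a::metric_space set"
  assumes "\<And>j. hausdorff_measure V d (X j) = 0"
  shows "hausdorff_measure V d (\<Union>j. X j) = 0"
  unfolding hausdorff_measure_eq_0_iff
proof (intro allI impI)
  fix \<epsilon> :: real and \<eta> :: ennreal assume \<epsilon>: "\<epsilon> > 0" and "\<eta> > 0"
  then obtain r :: real where r: "r > 0" "ennreal r < \<eta>"
    by (metis ennreal_less_zero_iff ennreal_rat_dense ennreal_0 of_rat_less_0_iff not_less ennreal_neg)
  \<comment> \<open>The \<open>j\<close>-th set is granted the budget \<open>r / 2^(j+1)\<close>, so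
    all covers together cost at most \<open>r\<close>, which is below \<eta>.\<close>
  have "\<exists>U. U \<in> hausdorff_covers V \<epsilon> (X j) \<and> (\<Sum>i. diam_power d (U i)) < ennreal (r * (1/2)^Suc j)" for j
    using assms[of j] \<epsilon> r unfolding hausdorff_measure_eq_0_iff
    by (metis ennreal_less_zero_iff half_gt_zero_iff zero_less_mult_iff zero_less_power zero_less_one)
  then obtain U where U: "\<And>j. U j \<in> hausdorff_covers V \<epsilon> (X j)"
    "\<And>j. (\<Sum>i. diam_power d (U j i)) < ennreal (r * (1/2)^Suc j)" by metis
  \<comment> \<open>The pairing function merges the double sequence of cover sets into a single
    one.\<close>
  define W where "W m = (case prod_decode m of (j, i) \<Rightarrow> U j i)" for m
  have "(\<Sum>m. diam_power d (W m)) = (\<Sum>j. \<Sum>i. diam_power d (U j i))"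
    using suminf_ennreal_2dimen[of "\<lambda>j. \<Sum>i. diam_power d (U j i)" "\<lambda>(j, i). diam_power d (U j i)"]
    by (simp add: W_def split_def comp_def)
  also have "\<dots> \<le> (\<Sum>j. ennreal (r * (1/2)^Suc j))"
    using U(2) by (intro suminf_le) (auto intro: less_imp_le)
  also have "\<dots> = ennreal r"
    using sums_mult[OF power_half_series, of r] r by (subst suminf_ennreal2) (auto simp: sums_iff)
  finally have "(\<Sum>m. diam_power d (W m)) < \<eta>" using r by simp
  moreover have "W \<in> hausdorff_covers V \<epsilon> (\<Union>j. X j)"
  proof -
    have "\<exists>m. p \<in> W m" if "p \<in> X j" for p j
    proof -
      obtain i where "p \<in> U j i" using U(1)[of j] \<open>p \<in> X j\<close> unfolding hausdorff_covers_def by blast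
      then have "p \<in> W (prod_encode (j, i))" by (simp add: W_def)
      then show ?thesis ..
    qed
    then show ?thesis
      using U(1) by (auto simp: hausdorff_covers_def W_def split: prod.splits)
  qed
  ultimately show "\<exists>U\<in>hausdorff_covers V \<epsilon> (\<Union>j. X j). (\<Sum>i. diam_power d (U i)) < \<eta>" by blast
qed

lemma hausdorff_measure_empty [simp]: "hausdorff_measure V d {} = 0"
  unfolding hausdorff_measure_eq_0_iff
proof (intro allI impI)
  fix \<epsilon> :: real and \<eta> :: ennreal assume \<epsilon>: "\<epsilon> > 0" and "\<eta> > 0"
  then show "\<exists>U\<in>hausdorff_covers V \<epsilon> {}. (\<Sum>i. diam_power d (U i)) < \<eta>"
    by (intro bexI[of _ "\<lambda>_. {}"]) (auto simp: diam_power_def hausdorff_covers_def)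
qed

lemma hausdorff_measure_0_UN:
  assumes "countable I" "\<And>j. j \<in> I \<Longrightarrow> hausdorff_measure V d (X j) = 0"
  shows "hausdorff_measure V d (\<Union>j\<in>I. X j) = 0"
proof (cases "I = {}")
  case False
  have "(\<Union>j\<in>I. X j) = (\<Union>m. X (from_nat_into I m))"
    using range_from_nat_into[OF False assms(1)] by (metis image_image)
  then show ?thesis
    using hausdorff_measure_0_UN_nat[of V d "\<lambda>m. X (from_nat_into I m)"] assms(2) from_nat_into[OF False] by simp
qed simp

text \<open>An \<open>L\<close>-Lipschitz map pushes a cover of scale \<open>\<epsilon> / L\<close>
  forward to one of scale \<epsilon>, and each term grows by a factor of at most
  \<open>L powr d\<close>.\<close>

lemma hausdorff_measure_0_Lipschitz_image:
  fixes f :: "'a::metric_space \<Rightarrow> 'b::metric_space"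
  assumes null: "hausdorff_measure V d X = 0" and "0 \<le> d" "f ` X \<subseteq> V'"
    and "\<And>u v. u \<in> X \<Longrightarrow> v \<in> X \<Longrightarrow> dist (f u) (f v) \<le> K * dist u v"
  shows "hausdorff_measure V' d (f ` X) = 0"
  unfolding hausdorff_measure_eq_0_iff
proof (intro allI impI)
  fix \<epsilon> :: real and \<eta> :: ennreal assume \<epsilon>: "\<epsilon> > 0" and \<eta>: "\<eta> > 0"
  \<comment> \<open>\<open>K\<close> may be zero or negative; a constant of at least 1 can be
    divided by.\<close>
  define L where "L = max K 1"
  have L: "L \<ge> 1" and Lip: "\<And>u v. u \<in> X \<Longrightarrow> v \<in> X \<Longrightarrow> dist (f u) (f v) \<le> L * dist u v"
    unfolding L_def by (simp, meson assms(4) max.cobounded1 mult_right_mono order.trans zero_le_dist)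
  have "\<eta> / ennreal (L powr d) > 0" 
    using \<eta> L by (simp add: ennreal_zero_less_divide)
  moreover have "\<epsilon> / L > 0" using \<epsilon> L by simp
  ultimately obtain U where U: "U \<in> hausdorff_covers V (\<epsilon> / L) X"
      "(\<Sum>i. diam_power d (U i)) < \<eta> / ennreal (L powr d)"
    using null unfolding hausdorff_measure_eq_0_iff by metis
  \<comment> \<open>The Lipschitz bound holds on \<open>X\<close> alone, so each cover set is cut
    down to \<open>X\<close> before it is mapped.\<close>
  define W where "W i = f ` (U i \<inter> X)" for i
  have b: "bounded (U i \<inter> X)" for i using U(1) by (auto simp: hausdorff_covers_def bounded_Int)
  have W: "bounded (W i)" "diameter (W i) \<le> L * diameter (U i \<inter> X)" for i
    unfolding W_def using diameter_mult_le[OF b, where K=L and f=f] L Lip by auto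
  have d: "diameter (U i \<inter> X) \<le> diameter (U i)" for i
    using U(1) by (intro diameter_subset) (auto simp: hausdorff_covers_def)
  have W': "diameter (W i) \<le> L * diameter (U i)" for i
    using W(2)[of i] mult_left_mono[OF d[of i], of L] L by linarith
  have "diameter (W i) < \<epsilon>" for i
  proof -
    have "diameter (U i) < \<epsilon> / L" using U(1) by (auto simp: hausdorff_covers_def)
    then have "L * diameter (U i) < \<epsilon>" using L by (simp add: field_simps)
    then show ?thesis using W'[of i] by linarith
  qed
  have cov: "W \<in> hausdorff_covers V' \<epsilon> (f ` X)"
  proof -
    have "f ` X \<subseteq> (\<Union>i. W i)" using U(1) by (fastforce simp: hausdorff_covers_def W_def)
    moreover have "W i \<subseteq> V'" for i using assms(3) by (auto simp: W_def)
    ultimately show ?thesis using W(1) \<open>\<And>i. diameter (W i) < \<epsilon>\<close> by (auto simp: hausdorff_covers_def)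
  qed
  have "diam_power d (W i) \<le> ennreal (L powr d) * diam_power d (U i)" for i
  proof (cases "W i = {} \<or> d = 0")
    case True
    then show ?thesis using L by (auto simp: diam_power_def W_def)
  next
    case False
    then have "U i \<noteq> {}" by (auto simp: W_def)
    have "diameter (W i) powr d \<le> (L * diameter (U i)) powr d"
      using W' W(1) assms(2) by (intro powr_mono2) (auto simp: diameter_ge_0)
    also have "\<dots> = L powr d * diameter (U i) powr d"
      using L U(1) by (intro powr_mult) 
    finally show ?thesis using False \<open>U i \<noteq> {}\<close>
      by (simp add: diam_power_def ennreal_mult[symmetric] ennreal_leI)
  qed
  then have "(\<Sum>i. diam_power d (W i)) \<le> (\<Sum>i. ennreal (L powr d) * diam_power d (U i))"
    by (intro suminf_le) auto
  also have "\<dots> = ennreal (L powr d) * (\<Sum>i. diam_power d (U i))" by simp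
  also have "\<dots> < \<eta>"
  proof -
    have "ennreal (L powr d) * (\<Sum>i. diam_power d (U i)) < ennreal (L powr d) * (\<eta> / ennreal (L powr d))"
      using U(2) L by (intro ennreal_mult_strict_left_mono) auto
    also have "\<dots> = \<eta>"
      using L by (subst mult.commute, subst ennreal_divide_times) simp
    finally show ?thesis .
  qed
  finally show "\<exists>U\<in>hausdorff_covers V' \<epsilon> (f ` X). (\<Sum>i. diam_power d (U i)) < \<eta>" using cov by blast
qed

section \<open>Hausdorff measure of subspaces and their images\<close>

lemma hausdorff_measure_0_finite_covers:
  fixes X :: "'a::metric_space set"
  assumes "X \<subseteq> V" "0 < d"
    and cov: "\<And>\<delta>. \<delta> > 0 \<Longrightarrow> \<exists>\<U> c. finite \<U> \<and> X \<subseteq> \<Union>\<U> \<and> 0 \<le> c \<and> c < \<delta> \<and> real (card \<U>) * c powr d < \<delta> \<and>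
           (\<forall>U\<in>\<U>. \<forall>u\<in>U. \<forall>v\<in>U. dist u v \<le> c)"
  shows "hausdorff_measure V d X = 0"
  unfolding hausdorff_measure_eq_0_iff
proof (intro allI impI)
  fix \<epsilon> :: real and \<eta> :: ennreal assume \<epsilon>: "\<epsilon> > 0" and \<eta>: "\<eta> > 0"
  then obtain r :: real where r: "r > 0" "ennreal r < \<eta>"
    by (metis ennreal_less_zero_iff ennreal_rat_dense)
  then have "min r \<epsilon> > 0" using \<epsilon> by simp
  from cov[OF this] obtain \<U> c where \<U>: "finite \<U>" "X \<subseteq> \<Union>\<U>" "0 \<le> c" "c < \<epsilon>" "real (card \<U>) * c powr d < r"
    and c: "\<And>U u v. U \<in> \<U> \<Longrightarrow> u \<in> U \<Longrightarrow> v \<in> U \<Longrightarrow> dist u v \<le> c"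
    by fastforce
  obtain h where h: "bij_betw h {..<card \<U>} \<U>"
    using ex_bij_betw_nat_finite[OF \<U>(1)] by (auto simp: atLeast0LessThan)
  \<comment> \<open>Cutting with \<open>V\<close> makes the sets admissible. The padding by empty
    sets is free, since they contribute 0 to the sum.\<close>
  define W where "W i = (if i < card \<U> then h i \<inter> V else {})" for i
  have dW: "dist u v \<le> c" if "u \<in> W i" "v \<in> W i" for u v i
    using that c[of "h i" u v] bij_betwE[OF h] by (auto simp: W_def split: if_splits)
  have bW: "bounded (W i)" for i
    unfolding bounded_two_points using dW by blast
  have diW: "diameter (W i) \<le> c" for i
    using dW \<U>(3) by (cases "W i = {}") (auto intro!: diameter_le simp: dist_norm[symmetric] diameter_def intro: cSUP_least)
  have "X \<subseteq> (\<Union>i. W i)"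
  proof
    fix p assume p: "p \<in> X"
    then obtain U where "U \<in> \<U>" "p \<in> U" using \<U>(2) by blast
    then obtain i where "i < card \<U>" "h i = U" using bij_betw_imp_surj_on[OF h] by (metis imageE lessThan_iff)
    then have "p \<in> W i" using p \<open>p \<in> U\<close> assms(1) by (auto simp: W_def)
    then show "p \<in> (\<Union>i. W i)" by blast
  qed
  then have "W \<in> hausdorff_covers V \<epsilon> X"
    using bW le_less_trans[OF diW \<U>(4)] by (auto simp: hausdorff_covers_def W_def)
  moreover have "(\<Sum>i. diam_power d (W i)) < \<eta>"
  proof -
    have "(\<Sum>i. diam_power d (W i)) = (\<Sum>i<card \<U>. diam_power d (W i))"
      by (rule suminf_finite) (auto simp: W_def diam_power_def)
    also have "\<dots> \<le> (\<Sum>i<card \<U>. ennreal (c powr d))"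
      using assms(2) diW bW by (intro sum_mono) (auto simp: diam_power_def intro!: ennreal_leI powr_mono2 diameter_ge_0)
    also have "\<dots> = ennreal (real (card \<U>) * c powr d)"
      by (simp add: ennreal_mult[symmetric] ennreal_of_nat_eq_real_of_nat)
    also have "\<dots> \<le> ennreal r" using \<U>(5) by (intro ennreal_leI) auto
    finally show ?thesis using r by simp
  qed
  ultimately show "\<exists>U\<in>hausdorff_covers V \<epsilon> X. (\<Sum>i. diam_power d (U i)) < \<eta>" by blast
qed

lemma inner_span_Basis_0:
  fixes B :: "'a::euclidean_space set"
  assumes "p \<in> span B" "B \<subseteq> Basis" "b \<in> Basis" "b \<notin> B"
  shows "p \<bullet> b = 0"
  using assms(1)
proof (induction rule: span_induct_alt)
  case (step c x y)
  then have "x \<bullet> b = 0" using assms by (metis inner_Basis subsetD)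
  then show ?case using step by (simp add: inner_add_left)
qed simp

text \<open>Grid count with \<open>m = card B\<close>: at most \<open>(2*k+1)^m\<close> cells of
  side \<open>r / k\<close> meet the ball, each of diameter at most \<open>m * r / k\<close>. The
  resulting sum is of order \<open>k powr (m - d)\<close>, which tends to 0.\<close>

lemma hausdorff_measure_0_span_ball:
  fixes B :: "'a::euclidean_space set"
  assumes B: "B \<subseteq> Basis" and d: "real (card B) < d" and r: "r > 0"
  shows "hausdorff_measure UNIV d (span B \<inter> cball 0 r) = 0"
proof (rule hausdorff_measure_0_finite_covers)
  show "0 < d" using d by linarith
  have finB: "finite B" using B finite_Basis finite_subset by blast
  fix \<delta> :: real assume \<delta>: "\<delta> > 0"
  define m where "m = card B"
  define c where "c k = real m * r / real k" for k :: nat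
  have c0: "c k \<ge> 0" for k using r by (simp add: c_def)
  have cells: "\<exists>\<U>. finite \<U> \<and> span B \<inter> cball 0 r \<subseteq> \<Union>\<U> \<and> card \<U> \<le> (2*k+1)^m \<and>
           (\<forall>U\<in>\<U>. \<forall>u\<in>U. \<forall>v\<in>U. dist u v \<le> c k)" if k: "k > 0" for k :: nat
  proof -
    define I where "I = (B \<rightarrow>\<^sub>E {- int k..int k})"
    \<comment> \<open>A cell collects the points of \<open>span B\<close> whose coordinates, in
      units of \<open>r / k\<close>, have prescribed integer parts.\<close>
    define cell where "cell u = {p \<in> span B. \<forall>b\<in>B. u b = \<lfloor>(p \<bullet> b) * k / r\<rfloor>}" for u
    have finI: "finite I" unfolding I_def using finB by (intro finite_PiE) auto
    have "card I = (2*k+1)^m" unfolding I_def m_def using finB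
      by (simp add: card_PiE) (simp add: nat_eq_iff add.commute nat_add_distrib nat_mult_distrib Suc_nat_eq_nat_zadd1)
    then have "card (cell ` I) \<le> (2*k+1)^m" using card_image_le[OF finI, of cell] by simp
    moreover have "span B \<inter> cball 0 r \<subseteq> \<Union>(cell ` I)"
    proof
      fix p assume p: "p \<in> span B \<inter> cball 0 r"
      define u where "u = (\<lambda>b\<in>B. \<lfloor>(p \<bullet> b) * k / r\<rfloor>)"
      have "\<lfloor>(p \<bullet> b) * k / r\<rfloor> \<in> {- int k..int k}" if "b \<in> B" for b
      proof -
        have "\<bar>p \<bullet> b\<bar> \<le> r" using p that B Basis_le_norm[of b p] by auto
        then have "\<bar>(p \<bullet> b) * k / r\<bar> \<le> k" using r k by (simp add: abs_mult field_simps)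
        then have "- real k \<le> (p \<bullet> b) * k / r" "(p \<bullet> b) * k / r \<le> k" by linarith+
        then show ?thesis unfolding atLeastAtMost_iff le_floor_iff floor_le_iff by simp
      qed
      then have "u \<in> I" by (auto simp: u_def I_def)
      moreover have "p \<in> cell u" using p by (auto simp: u_def cell_def)
      ultimately show "p \<in> \<Union>(cell ` I)" by blast
    qed
    moreover have "dist p q \<le> c k" if "p \<in> cell u" "q \<in> cell u" for p q u
    proof -
      have pq: "p - q \<in> span B" using that by (auto simp: cell_def intro: span_diff)
      have "dist p q \<le> (\<Sum>b\<in>Basis. \<bar>(p - q) \<bullet> b\<bar>)" by (simp add: dist_norm norm_le_l1)
      also have "\<dots> = (\<Sum>b\<in>B. \<bar>(p - q) \<bullet> b\<bar>)"
        using B inner_span_Basis_0[OF pq B] by (intro sum.mono_neutral_right) auto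
      also have "\<dots> \<le> (\<Sum>b\<in>B. r / k)"
      proof (intro sum_mono)
        fix b assume b: "b \<in> B"
        have "\<bar>(p \<bullet> b) * k / r - (q \<bullet> b) * k / r\<bar> \<le> 1"
        proof -
          have "\<lfloor>(p \<bullet> b) * k / r\<rfloor> = \<lfloor>(q \<bullet> b) * k / r\<rfloor>"
            using that b unfolding cell_def by force
          then show ?thesis by linarith
        qed
        then have "\<bar>(p - q) \<bullet> b\<bar> * k / r \<le> 1" using k r
          by (simp add: inner_diff_left left_diff_distrib[symmetric] diff_divide_distrib[symmetric] abs_mult)
        then show "\<bar>(p - q) \<bullet> b\<bar> \<le> r / k" using k r by (simp add: field_simps)
      qed
      finally show ?thesis by (simp add: c_def m_def)
    qed
    ultimately show ?thesis using finI by (intro exI[of _ "cell ` I"]) auto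
  qed
  have "(\<lambda>k. real k powr (real m - d)) \<longlonglongrightarrow> 0"
    using d by (intro tendsto_neg_powr filterlim_real_sequentially) (simp add: m_def)
  from tendsto_mult_right_zero[OF this, of "3^m * (m * r) powr d"]
  have "\<forall>\<^sub>F k in sequentially. 3^m * (m * r) powr d * real k powr (real m - d) < \<delta>"
    using \<delta> by (rule order_tendstoD)
  moreover have "c \<longlonglongrightarrow> 0" unfolding c_def by (intro lim_const_over_n)
  then have "\<forall>\<^sub>F k in sequentially. c k < \<delta>" using \<delta> by (rule order_tendstoD)
  ultimately have "\<forall>\<^sub>F k in sequentially. 3^m * (m * r) powr d * real k powr (real m - d) < \<delta> \<and> c k < \<delta> \<and> k > 0"
    using eventually_gt_at_top[of 0] by eventually_elim auto
  then obtain k :: nat where k: "3^m * (m * r) powr d * real k powr (real m - d) < \<delta>" "c k < \<delta>" "k > 0"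
    by (auto simp: eventually_sequentially)
  obtain \<U> where \<U>: "finite \<U>" "span B \<inter> cball 0 r \<subseteq> \<Union>\<U>" "card \<U> \<le> (2*k+1)^m"
           "\<forall>U\<in>\<U>. \<forall>u\<in>U. \<forall>v\<in>U. dist u v \<le> c k" using cells[OF k(3)] by blast
  have "card \<U> \<le> (3*k)^m" using \<U>(3) k(3) power_mono[of "2*k+1" "3*k" m] by linarith
  then have "real (card \<U>) \<le> real ((3*k)^m)" by (rule of_nat_mono)
  then have "real (card \<U>) * c k powr d \<le> real ((3*k)^m) * c k powr d" by (intro mult_right_mono) auto
  also have "\<dots> = 3^m * (m * r) powr d * real k powr (real m - d)"
    using k(3) r by (simp add: c_def powr_divide powr_diff powr_realpow power_mult_distrib)
  finally show "\<exists>\<U> c. finite \<U> \<and> span B \<inter> cball 0 r \<subseteq> \<Union>\<U> \<and> 0 \<le> c \<and> c < \<delta> \<and> real (card \<U>) * c powr d < \<delta> \<and>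
           (\<forall>U\<in>\<U>. \<forall>u\<in>U. \<forall>v\<in>U. dist u v \<le> c)"
    using \<U> k c0[of k] by (intro exI[of _ \<U>] exI[of _ "c k"]) auto
qed simp

text \<open>Grid and box covers need coordinate axes; a linear isometry onto a coordinate subspace
  of the same dimension makes them available for every subspace.\<close>

lemma obtain_coordinate_subspace:
  fixes W :: "'a::euclidean_space set"
  assumes "subspace W"
  obtains B :: "'a set" and f g where "B \<subseteq> Basis" "card B = dim W" "linear f" "linear g" 
    "f ` W = span B" "g ` span B = W"
    "\<And>p. p \<in> W \<Longrightarrow> norm (f p) = norm p" "\<And>p. p \<in> span B \<Longrightarrow> norm (g p) = norm p"
proof -
  obtain B :: "'a set" where B: "B \<subseteq> Basis" "card B = dim W"
    by (metis dim_subset_UNIV obtain_subset_with_card_n)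
  have "dim W = dim (span B)"
    using B independent_mono[OF independent_Basis B(1)] by (simp add: dim_eq_card_independent)
  from isometries_subspaces[OF assms subspace_span this] show ?thesis
    using that[OF B] by metis
qed

text \<open>The Lipschitz constant may grow with the radius, because \<open>W\<close> is exhausted
  by countably many balls and countable unions of null sets are null.\<close>

lemma hausdorff_measure_0_image_subspace:
  fixes W :: "'a::euclidean_space set" and f :: "'a \<Rightarrow> 'b::metric_space"
  assumes "subspace W" "real (dim W) < d" "f ` W \<subseteq> V"
    and Lip: "\<And>r. \<exists>K. \<forall>u \<in> W \<inter> cball 0 r. \<forall>v \<in> W \<inter> cball 0 r. dist (f u) (f v) \<le> K * dist u v"
  shows "hausdorff_measure V d (f ` W) = 0"
proof -
  obtain B :: "'a set" and h g where B: "B \<subseteq> Basis" "card B = dim W" "linear g" "g ` span B = W"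
    and g: "\<And>p. p \<in> span B \<Longrightarrow> norm (g p) = norm p"
    using obtain_coordinate_subspace[OF assms(1)] by metis
  have "f ` W = (\<Union>j::nat. (\<lambda>p. f (g p)) ` (span B \<inter> cball 0 (real (Suc j))))"
  proof -
    have "\<exists>j. p \<in> cball 0 (real (Suc j))" for p :: 'a
      using real_arch_simple[of "norm p"] by (auto intro!: exI[of _ "nat \<lceil>norm p\<rceil>"]) linarith
    then show ?thesis unfolding B(4)[symmetric] image_UN[symmetric] image_image[symmetric]
      by (intro arg_cong[where f="image f"] arg_cong[where f="image g"]) blast
  qed
  also have "hausdorff_measure V d \<dots> = 0"
  proof (rule hausdorff_measure_0_UN_nat)
    fix j :: nat
    obtain K where K: "\<And>u v. u \<in> W \<inter> cball 0 (real (Suc j)) \<Longrightarrow> v \<in> W \<inter> cball 0 (real (Suc j)) \<Longrightarrow> dist (f u) (f v) \<le> K * dist u v"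
      using Lip[of "real (Suc j)"] by blast
    show "hausdorff_measure V d ((\<lambda>p. f (g p)) ` (span B \<inter> cball 0 (real (Suc j)))) = 0"
    proof (rule hausdorff_measure_0_Lipschitz_image)
      show "hausdorff_measure UNIV d (span B \<inter> cball 0 (real (Suc j))) = 0"
        using assms(2) B by (intro hausdorff_measure_0_span_ball) auto
      show "0 \<le> d" using assms(2) by linarith
      show "(\<lambda>p. f (g p)) ` (span B \<inter> cball 0 (real (Suc j))) \<subseteq> V"
        using assms(3) B(4) by blast
      fix u v assume u: "u \<in> span B \<inter> cball 0 (real (Suc j))" and v: "v \<in> span B \<inter> cball 0 (real (Suc j))"
      then have "g u \<in> W \<inter> cball 0 (real (Suc j))" "g v \<in> W \<inter> cball 0 (real (Suc j))"
        using g B(4) by (auto simp del: of_nat_Suc)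
      moreover have "dist (g u) (g v) = dist u v"
        using u v g[of "u - v"] B(3) by (simp add: dist_norm linear_diff span_diff)
      ultimately show "dist (f (g u)) (f (g v)) \<le> K * dist u v" using K by metis
    qed
  qed
  finally show ?thesis .
qed

text \<open>Comparison with Lebesgue measure on the whole space. Each cover set gives rise to a box
  whose sides are twice its diameter along \<open>B\<close> and 1 along the other axes. These boxes
  cover the unit cube, so the sum of the \<open>m\<close>-th powers of the diameters cannot fall
  below \<open>1 / 2^m\<close>.\<close>

lemma hausdorff_measure_span_pos:
  fixes B :: "'a::euclidean_space set"
  assumes B: "B \<subseteq> Basis" "B \<noteq> {}"
  shows "hausdorff_measure UNIV (real (card B)) (span B) \<noteq> 0"
proof
  assume null: "hausdorff_measure UNIV (real (card B)) (span B) = 0"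
  have finB: "finite B" using B finite_Basis finite_subset by blast
  define m where "m = card B"
  have m: "m > 0" using B finB by (simp add: m_def card_gt_0_iff)
  have "(0::ennreal) < ennreal (1 / 2^m)" by simp
  then obtain U where U: "U \<in> hausdorff_covers UNIV 1 (span B)" and s: "(\<Sum>i. diam_power (real m) (U i)) < ennreal (1 / 2^m)"
    using null unfolding hausdorff_measure_eq_0_iff m_def by (metis zero_less_one)
  have bU: "bounded (U i)" for i using U by (auto simp: hausdorff_covers_def)
  define c where "c i = (SOME p. p \<in> U i)" for i
  define \<delta> where "\<delta> i = diameter (U i)" for i
  have \<delta>0: "\<delta> i \<ge> 0" for i using bU by (simp add: \<delta>_def diameter_ge_0)
  define lo where "lo i = (\<Sum>b\<in>Basis. (if b \<in> B then c i \<bullet> b - \<delta> i else 0) *\<^sub>R b)" for i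
  define hi where "hi i = (\<Sum>b\<in>Basis. (if b \<in> B then c i \<bullet> b + \<delta> i else 1) *\<^sub>R b)" for i
  define Q where "Q i = (if U i = {} then {} else cbox (lo i) (hi i))" for i
  have le: "lo i \<bullet> b \<le> hi i \<bullet> b" if "b \<in> Basis" for b i
    using \<delta>0[of i] that by (simp add: lo_def hi_def)
  have emQ: "emeasure lborel (Q i) \<le> ennreal (2^m) * diam_power (real m) (U i)" for i
  proof (cases "U i = {}")
    case False
    have "emeasure lborel (Q i) = (\<Prod>b\<in>Basis. (hi i - lo i) \<bullet> b)"
      using False le by (simp add: Q_def)
    also have "(\<Prod>b\<in>Basis. (hi i - lo i) \<bullet> b) = (\<Prod>b\<in>Basis. if b \<in> B then 2 * \<delta> i else 1)"
      by (intro prod.cong refl) (simp add: inner_diff_left lo_def hi_def)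
    also have "\<dots> = (\<Prod>b\<in>B. 2 * \<delta> i)"
      using B by (simp add: prod.If_cases Int_absorb1)
    also have "\<dots> = 2^m * \<delta> i powr m"
      using \<delta>0[of i] m by (cases "\<delta> i = 0") (simp_all add: m_def power_mult_distrib powr_realpow)
    finally show ?thesis using False m by (simp add: diam_power_def \<delta>_def ennreal_mult)
  qed (simp add: Q_def)
  have "cbox 0 One \<subseteq> (\<Union>i. Q i)"
  proof
    fix p :: 'a assume p: "p \<in> cbox 0 One"
    \<comment> \<open>The projection of \<open>p\<close> to \<open>span B\<close> lies in some cover
      set; the other coordinates of \<open>p\<close> lie between 0 and 1, as the box asks.\<close>
    define q where "q = (\<Sum>b\<in>B. (p \<bullet> b) *\<^sub>R b)"
    have "q \<in> span B" unfolding q_def by (intro span_sum span_scale span_base)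
    then obtain i where i: "q \<in> U i" using U by (auto simp: hausdorff_covers_def)
    then have ci: "c i \<in> U i" unfolding c_def by (rule someI)
    have qb: "q \<bullet> b = p \<bullet> b" if "b \<in> B" for b
    proof -
      have "q \<bullet> b = (\<Sum>b'\<in>B. if b' = b then p \<bullet> b else 0)"
        unfolding q_def inner_sum_left using B(1) that by (intro sum.cong refl) (auto simp: inner_Basis subset_iff)
      then show ?thesis using that finB by simp
    qed
    have "\<bar>p \<bullet> b - c i \<bullet> b\<bar> \<le> \<delta> i" if "b \<in> B" for b
    proof -
      have "\<bar>(q - c i) \<bullet> b\<bar> \<le> norm (q - c i)" using B that by (intro Basis_le_norm) auto
      also have "\<dots> \<le> \<delta> i" unfolding \<delta>_def using diameter_bounded_bound[OF bU i ci] by (simp add: dist_norm)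
      finally show ?thesis using qb[OF that] by (simp add: inner_diff_left)
    qed
    then have "p \<in> cbox (lo i) (hi i)"
      using p by (auto simp: mem_box lo_def hi_def abs_le_iff) (smt (verit))+
    then show "p \<in> (\<Union>i. Q i)" using i by (auto simp: Q_def)
  qed
  then have "emeasure lborel (cbox 0 One :: 'a set) \<le> emeasure lborel (\<Union>i. Q i)"
    by (intro emeasure_mono) (auto simp: Q_def)
  also have "\<dots> \<le> (\<Sum>i. emeasure lborel (Q i))"
    by (intro emeasure_subadditive_countably) (auto simp: Q_def)
  also have "\<dots> \<le> (\<Sum>i. ennreal (2^m) * diam_power (real m) (U i))"
    using emQ by (intro suminf_le) auto
  also have "\<dots> = ennreal (2^m) * (\<Sum>i. diam_power (real m) (U i))" by simp
  also have "\<dots> < ennreal (2^m) * ennreal (1 / 2^m)"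
    using s by (intro ennreal_mult_strict_left_mono) auto
  also have "\<dots> = 1" by (simp add: ennreal_mult[symmetric])
  finally show False by simp
qed

text \<open>A linear map is Lipschitz, so it cannot send a null set onto a superset of
  \<open>S\<close>, which has positive measure in its own dimension. By monotonicity in the
  exponent, no smaller exponent gives measure 0 either.\<close>

lemma hausdorff_dim_ge_subspace_image:
  fixes f :: "'a::euclidean_space \<Rightarrow> 'b::euclidean_space"
  assumes "subspace S" "dim S > 0" "linear f" "S \<subseteq> f ` X" "subspace V" "X \<subseteq> V"
  shows "real (dim S) \<le> hausdorff_dim V X"
proof -
  obtain B :: "'b set" and h g where B: "B \<subseteq> Basis" "card B = dim S" "linear h" "h ` S = span B"
    using obtain_coordinate_subspace[OF assms(1)] by metis
  have lin: "linear (\<lambda>p. h (f p))" using linear_compose[OF assms(3) B(3)] by (simp add: comp_def)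
  then obtain K where K: "\<And>p. norm (h (f p)) \<le> K * norm p"
    using linear_bounded by blast
  have pos: "hausdorff_measure V (real (dim S)) X \<noteq> 0"
  proof
    assume "hausdorff_measure V (real (dim S)) X = 0"
    then have "hausdorff_measure UNIV (real (dim S)) ((\<lambda>p. h (f p)) ` X) = 0"
      using K linear_diff[OF lin]
      by (intro hausdorff_measure_0_Lipschitz_image[where V=V and K=K]) (auto simp: dist_norm simp flip: linear_diff[OF lin])
    moreover have "span B \<subseteq> (\<lambda>p. h (f p)) ` X" unfolding B(4)[symmetric] using assms(4) by blast
    ultimately have "hausdorff_measure UNIV (real (card B)) (span B) = 0"
      using B(2) hausdorff_measure_0_subset by metis
    moreover have "B \<noteq> {}" using B(2) assms(2) by (metis card.empty less_numeral_extra(3))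
    ultimately show False using hausdorff_measure_span_pos[OF B(1)] by blast
  qed
  \<comment> \<open>Some exponent with measure 0 must be exhibited, because \<open>Inf\<close> of
    the empty set of reals carries no information.\<close>
  have "hausdorff_measure V (real (dim V) + 1) X = 0"
  proof -
    have "hausdorff_measure V (real (dim V) + 1) ((\<lambda>p. p) ` V) = 0"
      using assms by (intro hausdorff_measure_0_image_subspace exI[of _ 1]) auto
    then show ?thesis using assms(6) hausdorff_measure_0_subset by (metis image_ident)
  qed
  then show ?thesis unfolding hausdorff_dim_def
  proof (intro cInf_greatest)
    fix d assume d: "d \<in> {d. 0 \<le> d \<and> hausdorff_measure V d X = 0}"
    show "real (dim S) \<le> d"
    proof (rule ccontr)
      assume "\<not> ?thesis"
      then show False using d pos hausdorff_measure_0_mono[of V d X "real (dim S)"] by auto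
    qed
  qed (auto intro!: exI[of _ "real (dim V) + 1"])
qed

section \<open>Vertices of the elliptope\<close>

definition outer :: "real^'n \<Rightarrow> real^'n \<Rightarrow> real^'n^'n" where
  "outer a b = (\<chi> i j. a $ i * b $ j)"

lemma outer_mult_vector [simp]: "outer a b *v v = (b \<bullet> v) *\<^sub>R a"
  by (simp add: outer_def vec_eq_iff matrix_vector_mult_def inner_vec_def sum_distrib_left ac_simps)

lemma transpose_outer [simp]: "transpose (outer a b) = outer b a"
  by (simp add: outer_def transpose_def vec_eq_iff ac_simps)

lemma trace_mult_outer: "trace (Y ** outer x x) = x \<bullet> (Y *v x)"
  by (simp add: outer_def trace_def matrix_matrix_mult_def matrix_vector_mult_def inner_vec_def
      sum_distrib_left ac_simps)

lemma transpose_add: "transpose (A + B) = transpose A + transpose B"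
  by (simp add: transpose_def vec_eq_iff)

lemma transpose_diff: "transpose (A - B) = transpose A - transpose (B::real^'n^'m)"
  by (simp add: transpose_def vec_eq_iff)

lemma outer_self_sym [simp]: "outer a a \<in> sym_matrices"
  by (simp add: sym_matrices_def)

lemma outer_add_outer_sym [simp]: "outer a b + outer b a \<in> sym_matrices"
  by (simp add: sym_matrices_def transpose_add)

lemma subspace_sym_matrices: "subspace sym_matrices"
  by (auto simp: subspace_def sym_matrices_def transpose_add transpose_scalar)
    (simp add: transpose_def vec_eq_iff)

lemma sym_dot_swap:
  assumes "A \<in> sym_matrices"
  shows "u \<bullet> (A *v v) = v \<bullet> (A *v u)"
proof -
  have "u v* A = A *v u"
    using assms transpose_matrix_vector[of A u] by (simp add: sym_matrices_def)
  then have "u \<bullet> (A *v v) = (A *v u) \<bullet> v"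
    using dot_lmul_matrix[of u A v] by simp
  then show ?thesis by (simp add: inner_commute)
qed

lemma psd_sym: "C \<in> psd_matrices \<Longrightarrow> C \<in> sym_matrices"
  by (simp add: psd_matrices_def)

lemma psd_nonneg: "C \<in> psd_matrices \<Longrightarrow> 0 \<le> x \<bullet> (C *v x)"
  by (simp add: psd_matrices_def)

text \<open>At \<open>x + t C x\<close> the form equals \<open>2 * t * p + t^2 * q\<close>, where
  \<open>p\<close> is the squared norm of \<open>C *v x\<close>. A positive \<open>p\<close> would
  make this negative for small negative \<open>t\<close>.\<close>

lemma psd_mult_eq_0:
  assumes C: "C \<in> psd_matrices" and x: "x \<bullet> (C *v x) = 0"
  shows "C *v x = 0"
proof -
  define p where "p = (C *v x) \<bullet> (C *v x)"
  define q where "q = (C *v x) \<bullet> (C *v (C *v x))"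
  have *: "0 \<le> 2 * t * p + t\<^sup>2 * q" for t
  proof -
    have "0 \<le> (x + t *\<^sub>R (C *v x)) \<bullet> (C *v (x + t *\<^sub>R (C *v x)))"
      by (rule psd_nonneg[OF C])
    also have "\<dots> = 2 * t * p + t\<^sup>2 * q"
      using x sym_dot_swap[OF psd_sym[OF C], of x "C *v x"]
      by (simp add: matrix_vector_right_distrib matrix_vector_mult_scaleR inner_add_left inner_add_right
          p_def q_def power2_eq_square algebra_simps)
    finally show ?thesis .
  qed
  have q0: "q \<ge> 0" unfolding q_def by (rule psd_nonneg[OF C])
  have "p \<ge> 0" by (simp add: p_def)
  moreover have "\<not> p > 0"
  proof
    assume p: "p > 0"
    \<comment> \<open>The choice \<open>t = - p / (q + 1)\<close> avoids dividing by
      \<open>q\<close>, which may be 0.\<close>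
    have "2 * (- (p / (q + 1))) * p + (- (p / (q + 1)))\<^sup>2 * q = (p\<^sup>2 / (q + 1)) * (q / (q + 1) - 2)"
      using q0 by (simp add: divide_simps) (simp add: power2_eq_square algebra_simps)
    moreover have "(p\<^sup>2 / (q + 1)) * (q / (q + 1) - 2) < 0"
      using p q0 by (intro mult_pos_neg) (auto simp: field_simps)
    ultimately show False using *[of "- (p / (q + 1))"] by linarith
  qed
  ultimately show ?thesis by (simp add: p_def)
qed

section \<open>Entries of matrices in the elliptope and perturbations within it\<close>

lemma elliptope_diag: "X \<in> elliptope \<Longrightarrow> X $ i $ i = 1"
  by (auto simp: elliptope_def diag_def vec_eq_iff)

lemma elliptope_psd: "X \<in> elliptope \<Longrightarrow> X \<in> psd_matrices"
  by (simp add: elliptope_def)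

lemma axis_mult_axis: "axis i 1 \<bullet> (X *v axis j 1) = (X $ i $ j :: real)"
  by (simp add: inner_axis' matrix_vector_mult_basis column_def)

lemma sym_entry: "X \<in> sym_matrices \<Longrightarrow> X $ i $ j = X $ j $ i"
  by (metis axis_mult_axis sym_dot_swap)

text \<open>The form is nonnegative at the sum and at the difference of two unit vectors, which
  bounds the entry from both sides.\<close>

lemma elliptope_entry_le_1:
  assumes "X \<in> elliptope"
  shows "\<bar>X $ i $ j\<bar> \<le> 1"
proof -
  have *: "0 \<le> 1 + 2 * s * X $ i $ j + s * s" for s
  proof -
    have "0 \<le> (axis i 1 + s *\<^sub>R axis j 1) \<bullet> (X *v (axis i 1 + s *\<^sub>R axis j 1))"
      by (rule psd_nonneg[OF elliptope_psd[OF assms]])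
    also have "\<dots> = 1 + 2 * s * X $ i $ j + s * s"
      using sym_entry[OF psd_sym[OF elliptope_psd[OF assms]], of i j] elliptope_diag[OF assms]
      by (simp add: matrix_vector_right_distrib matrix_vector_mult_scaleR inner_add_left inner_add_right
          axis_mult_axis algebra_simps)
    finally show ?thesis .
  qed
  show ?thesis using *[of 1] *[of "-1"] by simp
qed

text \<open>The new matrix is the congruence of \<open>X\<close> by \<open>I + u s\<^sup>T\<close>.\<close>

lemma elliptope_perturb:
  fixes X :: "real^'n^'n"
  assumes X: "X \<in> elliptope" and s: "(axis i 1 + s) \<bullet> (X *v (axis i 1 + s)) = 1"
  defines "u \<equiv> axis i (1::real)"
  shows "X + (outer u (X *v s) + outer (X *v s) u) + (s \<bullet> (X *v s)) *\<^sub>R outer u u \<in> elliptope" (is "?Y \<in> _")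
proof -
  have sX: "X \<in> sym_matrices" using X by (intro psd_sym elliptope_psd)
  have sym: "?Y \<in> sym_matrices"
    by (intro subspace_add subspace_scale subspace_sym_matrices sX outer_self_sym outer_add_outer_sym)
  have "0 \<le> v \<bullet> (?Y *v v)" for v
  proof -
    have "v \<bullet> (?Y *v v) = (v + (u \<bullet> v) *\<^sub>R s) \<bullet> (X *v (v + (u \<bullet> v) *\<^sub>R s))"
      using sym_dot_swap[OF sX, of v s]
      by (simp add: matrix_vector_right_distrib matrix_vector_mult_add_rdistrib matrix_vector_mult_scaleR
          scaleR_matrix_vector_assoc[symmetric] inner_add_left inner_add_right inner_commute[of _ u]
          inner_commute[of "X *v s" v] algebra_simps)
    then show ?thesis using psd_nonneg[OF elliptope_psd[OF X]] by simp
  qed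
  moreover have "?Y $ k $ k = 1" for k
  proof -
    \<comment> \<open>This is the change of the \<open>i\<close>-th diagonal entry; it vanishes by
      the normalization of \<open>s\<close>.\<close>
    have "2 * (X *v s) $ i + s \<bullet> (X *v s) = 0"
      using s sym_dot_swap[OF sX, of s "axis i 1"] elliptope_diag[OF X, of i] axis_mult_axis[of i X i]
      by (simp add: matrix_vector_right_distrib inner_add_left inner_add_right axis_mult_axis inner_axis')
    then show ?thesis
      using elliptope_diag[OF X, of k] by (simp add: outer_def u_def axis_def)
  qed
  ultimately show ?thesis using sym by (simp add: elliptope_def psd_matrices_def diag_def vec_eq_iff)
qed

lemma inner_outer: "A \<bullet> outer a b = a \<bullet> (A *v b)"
  by (simp add: outer_def inner_vec_def matrix_vector_mult_def sum_distrib_left ac_simps)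

text \<open>View \<open>X\<close> as the Gram matrix of unit vectors. Replacing the
  \<open>i\<close>-th vector by unit combinations of the \<open>i\<close>-th and the
  \<open>j\<close>-th gives a curve in the elliptope through \<open>X\<close>. A normal vector
  \<open>A\<close> attains its maximum along the curve at \<open>X\<close>, so the derivative there
  vanishes, and this is a linear condition on \<open>A\<close>.\<close>

lemma elliptope_normal_orthogonal:
  fixes X :: "real^'n^'n"
  assumes X: "X \<in> elliptope" and c: "\<bar>X $ i $ j\<bar> < 1"
    and A: "A \<in> normal_cone sym_matrices elliptope X"
  shows "(X *v axis j 1 - (X $ i $ j) *\<^sub>R (X *v axis i 1)) \<bullet> (A *v axis i 1) = 0"
proof -
  have sX: "X \<in> sym_matrices" using X by (intro psd_sym elliptope_psd)
  have sA: "A \<in> sym_matrices" using A by (simp add: normal_cone_def)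
  define c where "c = X $ i $ j"
  define u where "u = axis i (1::real)"
  define w where "w = axis j (1::real)"
  have uu: "u \<bullet> (X *v u) = 1" and ww: "w \<bullet> (X *v w) = 1" and uw: "u \<bullet> (X *v w) = c" and wu: "w \<bullet> (X *v u) = c"
    using elliptope_diag[OF X] sym_entry[OF sX, of i j] by (simp_all add: u_def w_def axis_mult_axis c_def)
  \<comment> \<open>The root with \<open>\<alpha> 0 = 1\<close> of the quadratic equation which says
    that \<open>\<alpha> t *\<^sub>R u + t *\<^sub>R w\<close> has unit length for the form of
    \<open>X\<close>.\<close>
  define \<alpha> where "\<alpha> t = sqrt (1 - t\<^sup>2 * (1 - c\<^sup>2)) - t * c" for t
  define s where "s t = (\<alpha> t - 1) *\<^sub>R u + t *\<^sub>R w" for t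
  have c1: "c\<^sup>2 < 1" using c by (simp add: c_def abs_square_less_1)
  have Q: "(u + s t) \<bullet> (X *v (u + s t)) = 1" if "\<bar>t\<bar> \<le> 1" for t
  proof -
    have "0 \<le> 1 - t\<^sup>2 * (1 - c\<^sup>2)"
      using that c1 mult_mono[of "t\<^sup>2" 1 "1 - c\<^sup>2" 1] by (simp add: abs_square_le_1 abs_square_less_1)
    then have sq: "(\<alpha> t + t * c)\<^sup>2 = 1 - t\<^sup>2 * (1 - c\<^sup>2)" by (simp add: \<alpha>_def)
    have "u + s t = \<alpha> t *\<^sub>R u + t *\<^sub>R w" by (simp add: s_def algebra_simps)
    then have "(u + s t) \<bullet> (X *v (u + s t)) = (\<alpha> t)\<^sup>2 + 2 * \<alpha> t * t * c + t\<^sup>2"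
      using uu ww uw wu by (simp add: matrix_vector_right_distrib matrix_vector_mult_scaleR inner_add_left inner_add_right
          power2_eq_square algebra_simps)
    also have "\<dots> = (\<alpha> t + t * c)\<^sup>2 + t\<^sup>2 * (1 - c\<^sup>2)" by (simp add: power2_eq_square algebra_simps)
    finally show ?thesis using sq by simp
  qed
  \<comment> \<open>\<open>g (s t)\<close> is half the increment of the inner product with
    \<open>A\<close> along the curve. The unit length condition turns the term quadratic in
    \<open>s t\<close> into a linear one, so \<open>g\<close> is linear.\<close>
  define g where "g v = (X *v v) \<bullet> (A *v u) - (A $ i $ i) * (u \<bullet> (X *v v))" for v
  have gs: "g (s t) \<le> 0" if "\<bar>t\<bar> \<le> 1" for t
  proof -
    let ?Y = "X + (outer u (X *v s t) + outer (X *v s t) u) + (s t \<bullet> (X *v s t)) *\<^sub>R outer u u"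
    have "?Y \<in> elliptope"
      using elliptope_perturb[OF X, of i "s t"] Q[OF that] by (simp add: u_def)
    then have "A \<bullet> ?Y \<le> A \<bullet> X" using A by (simp add: normal_cone_def)
    then have "2 * ((X *v s t) \<bullet> (A *v u)) + (s t \<bullet> (X *v s t)) * (A $ i $ i) \<le> 0"
      using sym_dot_swap[OF sA, of u "X *v s t"]
      by (simp add: inner_add_right inner_outer u_def axis_mult_axis)
    moreover have "s t \<bullet> (X *v s t) = - 2 * (u \<bullet> (X *v s t))"
      using Q[OF that] uu sym_dot_swap[OF sX, of "s t" u]
      by (simp add: matrix_vector_right_distrib inner_add_left inner_add_right)
    ultimately show ?thesis by (simp add: g_def mult.commute)
  qed
  have g_lin: "g (s t) = (\<alpha> t - 1) * g u + t * g w" for t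
    by (simp add: g_def s_def matrix_vector_right_distrib matrix_vector_mult_scaleR inner_add_left inner_add_right
        algebra_simps)
  have "((\<lambda>t. g (s t)) has_real_derivative (- c * g u + g w)) (at 0)"
    unfolding g_lin \<alpha>_def by (auto intro!: derivative_eq_intros)
  moreover have "g (s t) \<le> g (s 0)" if "\<bar>0 - t\<bar> < 1" for t
    using gs[of t] that by (simp add: g_lin \<alpha>_def)
  ultimately have "- c * g u + g w = 0"
    using DERIV_local_max[of "\<lambda>t. g (s t)" "- c * g u + g w" 0 1] by auto
  then show ?thesis
    using uu uw by (simp add: g_def u_def[symmetric] w_def[symmetric] c_def[symmetric] inner_diff_left algebra_simps)
qed

text \<open>An entry of modulus below 1 would confine the normal cone to the subspace
  \<open>T\<close>. Since the cone is full-dimensional, \<open>T\<close> would be all of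
  \<open>sym_matrices\<close>, which one test matrix refutes.\<close>

lemma elliptope_vertex_entries:
  fixes X :: "real^'n^'n"
  assumes "is_vertex sym_matrices elliptope X"
  shows "\<bar>X $ i $ j\<bar> = 1"
proof (rule ccontr)
  have X: "X \<in> elliptope" using assms by (simp add: is_vertex_def)
  have sX: "X \<in> sym_matrices" using X by (intro psd_sym elliptope_psd)
  assume "\<not> ?thesis"
  then have c: "\<bar>X $ i $ j\<bar> < 1" using elliptope_entry_le_1[OF X, of i j] by linarith
  define g where "g = X *v axis j 1 - (X $ i $ j) *\<^sub>R (X *v axis i 1)"
  define T where "T = sym_matrices \<inter> {A. g \<bullet> (A *v axis i 1) = 0}"
  have subS: "subspace (sym_matrices :: (real^'n^'n) set)" by (rule subspace_sym_matrices)
  have sub: "subspace T" unfolding T_def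
    by (intro subspace_inter subspace_sym_matrices)
      (auto simp: subspace_def matrix_vector_mult_add_rdistrib inner_add_right scaleR_matrix_vector_assoc[symmetric])
  have "normal_cone sym_matrices elliptope X \<subseteq> T"
    using elliptope_normal_orthogonal[OF X c] by (auto simp: T_def g_def normal_cone_def)
  then have "aff_dim (normal_cone sym_matrices elliptope X) \<le> aff_dim T" by (rule aff_dim_subset)
  then have "dim (sym_matrices :: (real^'n^'n) set) \<le> dim T"
    using assms aff_dim_subspace[OF sub] aff_dim_subspace[OF subS] by (simp add: is_vertex_def)
  then have T: "T = sym_matrices"
    using subspace_dim_equal[OF sub subspace_sym_matrices] by (auto simp: T_def)
  have ij: "i \<noteq> j" using c elliptope_diag[OF X] by auto
  \<comment> \<open>For this matrix the condition defining \<open>T\<close> reads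
    \<open>g $ j = 0\<close>, whereas \<open>g $ j\<close> is 1 minus the square of the
    entry.\<close>
  have "outer (axis i 1) (axis j 1) + outer (axis j 1) (axis i 1) \<in> T" unfolding T by simp
  then have "g $ j = 0" using ij
    by (simp add: T_def matrix_vector_mult_add_rdistrib inner_axis inner_add_right) (simp add: axis_def)
  moreover have "g $ j = 1 - (X $ i $ j)\<^sup>2"
    using axis_mult_axis[of j X j] axis_mult_axis[of j X i] sym_entry[OF sX, of i j] elliptope_diag[OF X, of j]
    by (simp add: g_def inner_axis' power2_eq_square)
  ultimately have "(X $ i $ j)\<^sup>2 = 1" by simp
  then show False using c by (simp add: abs_square_eq_1)
qed

text \<open>As the entries are 1 or -1, the form of \<open>X\<close> vanishes at
  \<open>axis i 1 - (X $ i $ j) *\<^sub>R axis j 1\<close>. This vector therefore lies in the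
  kernel, so any two columns agree up to sign.\<close>

lemma elliptope_vertex_rank_one:
  fixes X :: "real^'n^'n"
  assumes "is_vertex sym_matrices elliptope X"
  obtains x where "\<And>i. \<bar>x $ i\<bar> = 1" "X = outer x x"
proof -
  have X: "X \<in> elliptope" using assms by (simp add: is_vertex_def)
  have sX: "X \<in> sym_matrices" using X by (intro psd_sym elliptope_psd)
  have e: "\<bar>X $ i $ j\<bar> = 1" for i j by (rule elliptope_vertex_entries[OF assms])
  have *: "X $ k $ i = X $ i $ j * X $ k $ j" for i j k
  proof -
    let ?u = "axis i 1 - (X $ i $ j) *\<^sub>R axis j (1::real)"
    have "X $ i $ j * X $ i $ j = 1" using e[of i j] by (auto simp: abs_if split: if_splits)
    then have "?u \<bullet> (X *v ?u) = 0"
      using elliptope_diag[OF X] sym_entry[OF sX, of i j]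
      by (simp add: matrix_vector_mult_diff_distrib matrix_vector_mult_scaleR inner_diff_left inner_diff_right
          axis_mult_axis)
    then have "X *v ?u = 0" by (rule psd_mult_eq_0[OF elliptope_psd[OF X]])
    then have "axis k 1 \<bullet> (X *v ?u) = 0" by simp
    then show ?thesis
      by (simp add: matrix_vector_mult_diff_distrib matrix_vector_mult_scaleR inner_diff_right axis_mult_axis)
  qed
  \<comment> \<open>An arbitrary index: every column of \<open>X\<close> can serve as
    \<open>x\<close>.\<close>
  define j :: 'n where "j = undefined"
  show ?thesis
  proof
    show "\<bar>(\<chi> k. X $ k $ j) $ i\<bar> = 1" for i using e by simp
    show "X = outer (\<chi> k. X $ k $ j) (\<chi> k. X $ k $ j)"
      using * by (simp add: outer_def vec_eq_iff mult.commute)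
  qed
qed

section \<open>The relative frontier of the face\<close>

definition sym_null :: "real^'n \<Rightarrow> (real^'n^'n) set" where
  "sym_null x = {C \<in> sym_matrices. C *v x = 0}"

definition psd_null :: "real^'n \<Rightarrow> (real^'n^'n) set" where
  "psd_null x = {C \<in> psd_matrices. C *v x = 0}"

lemma psd_null_sym_null: "C \<in> psd_null x \<Longrightarrow> C \<in> sym_null x"
  by (simp add: psd_null_def sym_null_def psd_sym)

text \<open>The trace condition says that the form of \<open>C\<close> vanishes at \<open>x\<close>,
  which for a semidefinite matrix puts \<open>x\<close> into the kernel.\<close>

lemma psd_inter_trace_perp_outer: "psd_matrices \<inter> trace_perp (outer x x) = psd_null x"
proof -
  have "x \<bullet> (C *v x) = 0 \<longleftrightarrow> C *v x = 0" if "C \<in> psd_matrices" for C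
    using psd_mult_eq_0[OF that] by auto
  then show ?thesis
    using psd_sym by (auto simp: psd_null_def trace_perp_def trace_mult_outer)
qed

lemma subspace_sym_null: "subspace (sym_null x)"
proof -
  have "sym_null x = sym_matrices \<inter> {C. C *v x = 0}" by (auto simp: sym_null_def)
  moreover have "subspace {C. C *v x = 0}"
    by (auto simp: subspace_def matrix_vector_mult_add_rdistrib scaleR_matrix_vector_assoc[symmetric])
  ultimately show ?thesis using subspace_inter[OF subspace_sym_matrices] by metis
qed

lemma sym_null_perp:
  assumes "C \<in> sym_null x"
  shows "x \<bullet> (C *v v) = 0"
  using assms sym_dot_swap[of C x v] by (simp add: sym_null_def)

text \<open>Since \<open>C\<close> is symmetric with \<open>C *v x = 0\<close>, removing the
  \<open>x\<close>-component of a vector does not change the value of the form.\<close>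

lemma sym_null_psd_nullI:
  fixes C :: "real^'n^'n"
  assumes C: "C \<in> sym_null x" and x: "x \<noteq> 0"
    and pos: "\<And>z. x \<bullet> z = 0 \<Longrightarrow> 0 \<le> z \<bullet> (C *v z)"
  shows "C \<in> psd_null x"
proof -
  have Cx: "C *v x = 0" and sC: "C \<in> sym_matrices" using C by (auto simp: sym_null_def)
  have "0 \<le> v \<bullet> (C *v v)" for v
  proof -
    define z where "z = v - ((x \<bullet> v) / (x \<bullet> x)) *\<^sub>R x"
    have "x \<bullet> z = 0" using x by (simp add: z_def inner_diff_right)
    then have "0 \<le> z \<bullet> (C *v z)" by (rule pos)
    also have "z \<bullet> (C *v z) = v \<bullet> (C *v v)"
      using sym_null_perp[OF C, of v]
      by (simp add: z_def matrix_vector_mult_diff_distrib matrix_vector_mult_scaleR Cx inner_diff_left)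
    finally show ?thesis .
  qed
  then show ?thesis using Cx sC by (simp add: psd_null_def psd_matrices_def)
qed

lemma convex_psd_null: "convex (psd_null x)"
  unfolding psd_null_def psd_matrices_def
  by (auto simp: convex_def matrix_vector_mult_add_rdistrib scaleR_matrix_vector_assoc[symmetric] inner_add_right
      intro!: subspace_add subspace_scale subspace_sym_matrices add_nonneg_nonneg mult_nonneg_nonneg)

lemma continuous_on_matrix_vector_left: "continuous_on S (\<lambda>C::real^'n^'m. C *v x)"
proof -
  have "linear (\<lambda>C::real^'n^'m. C *v x)"
    by (auto intro!: linearI simp: matrix_vector_mult_add_rdistrib scaleR_matrix_vector_assoc[symmetric])
  then show ?thesis by (rule linear_continuous_on_compose[OF continuous_on_id])
qed

lemma closed_psd_null: "closed (psd_null (x :: real^'n))"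
proof -
  have "closed {C::real^'n^'n. 0 \<le> v \<bullet> (C *v v)}" for v
    by (intro closed_Collect_le continuous_intros continuous_on_matrix_vector_left)
  then have "closed (\<Inter>v. {C::real^'n^'n. 0 \<le> v \<bullet> (C *v v)})" by blast
  moreover have "psd_null x = sym_null x \<inter> (\<Inter>v. {C. 0 \<le> v \<bullet> (C *v v)})"
    by (auto simp: psd_null_def sym_null_def psd_matrices_def)
  ultimately show ?thesis using closed_subspace[OF subspace_sym_null] by auto
qed

text \<open>The least Rayleigh quotient on the complement of \<open>x\<close> is attained: the unit
  sphere of the complement is compact, and it is nonempty in dimension at least 2. Scaling extends
  the bound to all \<open>w\<close>.\<close>

lemma quadratic_form_min_on_perp:
  fixes C :: "real^'n^'n" and x :: "real^'n"
  assumes "CARD('n) \<ge> 2"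
  obtains z where "norm z = 1" "x \<bullet> z = 0"
    "\<And>w. x \<bullet> w = 0 \<Longrightarrow> (z \<bullet> (C *v z)) * (w \<bullet> w) \<le> w \<bullet> (C *v w)"
proof -
  define K where "K = sphere 0 1 \<inter> {z. x \<bullet> z = 0}"
  obtain y where y: "y \<noteq> 0" "orthogonal x y"
    using orthogonal_to_vector_exists[of x] assms by auto
  then have "y /\<^sub>R norm y \<in> K" by (simp add: K_def orthogonal_def)
  then have "K \<noteq> {}" by blast
  moreover have "compact K" unfolding K_def by (intro compact_Int_closed closed_hyperplane) simp
  moreover have "continuous_on K (\<lambda>z. z \<bullet> (C *v z))"
    by (intro continuous_intros matrix_vector_mult_linear_continuous_on)
  ultimately have "\<exists>z\<in>K. \<forall>w\<in>K. z \<bullet> (C *v z) \<le> w \<bullet> (C *v w)"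
    by (intro continuous_attains_inf)
  then obtain z where z: "z \<in> K" "\<And>w. w \<in> K \<Longrightarrow> z \<bullet> (C *v z) \<le> w \<bullet> (C *v w)" by blast
  show ?thesis
  proof
    show "norm z = 1" "x \<bullet> z = 0" using z by (auto simp: K_def)
    fix w assume w: "x \<bullet> w = 0"
    show "(z \<bullet> (C *v z)) * (w \<bullet> w) \<le> w \<bullet> (C *v w)"
    proof (cases "w = 0")
      case False
      then have "w /\<^sub>R norm w \<in> K" using w by (simp add: K_def)
      from z(2)[OF this] have "z \<bullet> (C *v z) \<le> (w \<bullet> (C *v w)) / (norm w * norm w)"
        by (simp add: matrix_vector_mult_scaleR divide_inverse mult.commute mult.left_commute)
      also have "norm w * norm w = w \<bullet> w"
        by (simp add: norm_eq_sqrt_inner)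
      finally show ?thesis using False by (simp add: pos_le_divide_eq)
    qed simp
  qed
qed

definition perp_proj :: "real^'n \<Rightarrow> real^'n^'n" where
  "perp_proj x = mat 1 - (1 / (x \<bullet> x)) *\<^sub>R outer x x"

lemma perp_proj_mult: "perp_proj x *v v = v - ((x \<bullet> v) / (x \<bullet> x)) *\<^sub>R x"
  by (simp add: perp_proj_def matrix_vector_mult_diff_rdistrib scaleR_matrix_vector_assoc[symmetric])

lemma perp_proj_sym_null: "x \<noteq> 0 \<Longrightarrow> perp_proj x \<in> sym_null x"
  by (simp add: sym_null_def perp_proj_mult)
     (simp add: perp_proj_def sym_matrices_def transpose_diff transpose_scalar)

lemma perp_proj_psd_null: "x \<noteq> 0 \<Longrightarrow> perp_proj x \<in> psd_null x"
  by (intro sym_null_psd_nullI perp_proj_sym_null) (auto simp: perp_proj_mult)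

text \<open>A point is relatively interior iff every segment from the face to it extends beyond it.
  A kernel vector orthogonal to \<open>x\<close> blocks the segment from \<open>perp_proj x\<close>.
  Without one, the form of \<open>C\<close> has a positive minimum \<open>t\<close> on the unit
  sphere of the complement, which leaves room to extend every segment.\<close>

lemma rel_frontier_psd_null:
  fixes x :: "real^'n"
  assumes n: "CARD('n) \<ge> 2" and x: "x \<noteq> 0"
  shows "rel_frontier (psd_null x) = {C \<in> psd_null x. \<exists>z. z \<noteq> 0 \<and> x \<bullet> z = 0 \<and> C *v z = 0}"
proof -
  have "C \<notin> rel_interior (psd_null x) \<longleftrightarrow> (\<exists>z. z \<noteq> 0 \<and> x \<bullet> z = 0 \<and> C *v z = 0)" if C: "C \<in> psd_null x" for C
  proof
    assume "\<exists>z. z \<noteq> 0 \<and> x \<bullet> z = 0 \<and> C *v z = 0"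
    then obtain z where z: "z \<noteq> 0" "x \<bullet> z = 0" "C *v z = 0" by blast
    show "C \<notin> rel_interior (psd_null x)"
    proof
      assume "C \<in> rel_interior (psd_null x)"
      then obtain e where e: "e > 1" "(1 - e) *\<^sub>R perp_proj x + e *\<^sub>R C \<in> psd_null x"
        using convex_rel_interior_iff[OF convex_psd_null] perp_proj_psd_null[OF x] by blast
      then have "0 \<le> z \<bullet> (((1 - e) *\<^sub>R perp_proj x + e *\<^sub>R C) *v z)"
        by (intro psd_nonneg) (auto simp: psd_null_def)
      also have "\<dots> = (1 - e) * (z \<bullet> z)"
        using z by (simp add: matrix_vector_mult_add_rdistrib scaleR_matrix_vector_assoc[symmetric] perp_proj_mult)
      also have "\<dots> < 0" using e z by (intro mult_neg_pos) auto
      finally show False by simp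
    qed
  next
    assume nint: "C \<notin> rel_interior (psd_null x)"
    obtain z where z: "norm z = 1" "x \<bullet> z = 0"
      and zmin: "\<And>w. x \<bullet> w = 0 \<Longrightarrow> (z \<bullet> (C *v z)) * (w \<bullet> w) \<le> w \<bullet> (C *v w)"
      using quadratic_form_min_on_perp[OF n] by blast
    define t where "t = z \<bullet> (C *v z)"
    have t0: "t \<ge> 0" unfolding t_def using C by (intro psd_nonneg) (simp add: psd_null_def)
    have "t = 0"
    proof (rule ccontr)
      assume "t \<noteq> 0"
      then have t: "t > 0" using t0 by simp
      have "\<exists>e>1. (1 - e) *\<^sub>R Y + e *\<^sub>R C \<in> psd_null x" if Y: "Y \<in> psd_null x" for Y
      proof -
        \<comment> \<open>Minimizing the form of \<open>-Y\<close> yields the largest Rayleigh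
          quotient \<open>M\<close> of \<open>Y\<close>.\<close>
        obtain y where y: "norm y = 1" "x \<bullet> y = 0"
          and ymin: "\<And>w. x \<bullet> w = 0 \<Longrightarrow> (y \<bullet> ((-Y) *v y)) * (w \<bullet> w) \<le> w \<bullet> ((-Y) *v w)"
          using quadratic_form_min_on_perp[OF n] by blast
        define M where "M = y \<bullet> (Y *v y)"
        have neg: "(-Y) *v w = - (Y *v w)" for w
          using scaleR_matrix_vector_assoc[of "-1" Y w] by simp
        have M: "w \<bullet> (Y *v w) \<le> M * (w \<bullet> w)" if "x \<bullet> w = 0" for w
          using ymin[OF that] by (simp add: neg M_def)
        have M0: "M \<ge> 0" unfolding M_def using Y by (intro psd_nonneg) (simp add: psd_null_def)
        \<comment> \<open>Chosen so that \<open>(e - 1) * M \<le> t\<close>; the summand 1 in the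
          denominator covers \<open>M = 0\<close>.\<close>
        define e where "e = 1 + t / (M + 1)"
        have e: "e > 1" using t M0 by (simp add: e_def)
        have eM: "(e - 1) * M \<le> t" using t M0 by (simp add: e_def field_simps)
        have "(1 - e) *\<^sub>R Y + e *\<^sub>R C \<in> psd_null x"
        proof (rule sym_null_psd_nullI[OF _ x])
          show "(1 - e) *\<^sub>R Y + e *\<^sub>R C \<in> sym_null x"
            by (intro subspace_add subspace_scale subspace_sym_null psd_null_sym_null Y C)
          fix w assume w: "x \<bullet> w = 0"
          have "(e - 1) * (w \<bullet> (Y *v w)) \<le> (e - 1) * (M * (w \<bullet> w))"
            using e M[OF w] by (intro mult_left_mono) auto
          also have "\<dots> \<le> t * (w \<bullet> w)"
            using mult_right_mono[OF eM, of "w \<bullet> w"] by (simp add: mult.assoc)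
          also have "\<dots> \<le> w \<bullet> (C *v w)" using zmin[OF w] by (simp add: t_def)
          also have "\<dots> \<le> e * (w \<bullet> (C *v w))"
            using e psd_nonneg[of C w] C mult_right_mono[of 1 e "w \<bullet> (C *v w)"] by (simp add: psd_null_def)
          finally show "0 \<le> w \<bullet> (((1 - e) *\<^sub>R Y + e *\<^sub>R C) *v w)"
            by (simp add: matrix_vector_mult_add_rdistrib scaleR_matrix_vector_assoc[symmetric] inner_add_right algebra_simps)
        qed
        then show ?thesis using e by blast
      qed
      then have "C \<in> rel_interior (psd_null x)"
        using convex_rel_interior_iff[OF convex_psd_null, of x C] C by blast
      then show False using nint by simp
    qed
    then have "C *v z = 0" using C psd_mult_eq_0[of C z] by (simp add: t_def psd_null_def)
    then show "\<exists>z. z \<noteq> 0 \<and> x \<bullet> z = 0 \<and> C *v z = 0" using z by (intro exI[of _ z]) auto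
  qed
  then show ?thesis unfolding rel_frontier_def closure_closed[OF closed_psd_null] by blast
qed

text \<open>Every \<open>Y\<close> in this hyperplane is the projection of \<open>Y - \<lambda> J\<close>, where \<open>J\<close> is \<open>perp_proj x\<close> and \<open>\<lambda>\<close> is the least
  eigenvalue of \<open>Y\<close> on the complement of \<open>x\<close>, and this matrix lies in the relative frontier.\<close>

definition sym_null_hyperplane :: "real^'n \<Rightarrow> (real^'n^'n) set" where
  "sym_null_hyperplane x = sym_null x \<inter> {C. perp_proj x \<bullet> C = 0}"

lemma subspace_sym_null_hyperplane: "subspace (sym_null_hyperplane x)"
  unfolding sym_null_hyperplane_def by (intro subspace_inter subspace_sym_null subspace_hyperplane)

lemma dim_sym_null_le:
  assumes x: "x \<noteq> 0"
  shows "dim (sym_null x) \<le> dim (sym_null_hyperplane x) + 1"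
proof -
  let ?J = "perp_proj x"
  have "sym_null x \<subseteq> span (insert ?J (sym_null_hyperplane x))"
  proof
    fix C assume C: "C \<in> sym_null x"
    \<comment> \<open>The coefficient of the orthogonal projection to the line of \<open>?J\<close>.
      If \<open>?J\<close> is 0, the quotient is 0 and the hyperplane is all of
      \<open>sym_null x\<close>.\<close>
    define k where "k = (?J \<bullet> C) / (?J \<bullet> ?J)"
    have "C - k *\<^sub>R ?J \<in> sym_null_hyperplane x"
      using C perp_proj_sym_null[OF x]
      by (auto simp: sym_null_hyperplane_def k_def inner_diff_right intro!: subspace_diff subspace_scale subspace_sym_null)
    then show "C \<in> span (insert ?J (sym_null_hyperplane x))"
      unfolding span_insert by (auto intro!: exI[of _ k] span_base)
  qed
  then have "dim (sym_null x) \<le> dim (insert ?J (sym_null_hyperplane x))" by (rule dim_mono)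
  then show ?thesis by (simp add: dim_insert split: if_splits)
qed

section \<open>Matrices with a prescribed kernel vector\<close>

text \<open>If \<open>C z = 0\<close> and \<open>a \<bullet> z = 1\<close>, then \<open>P = I - z a\<^sup>T\<close> satisfies \<open>P\<^sup>T C P = C\<close>, and \<open>P\<^sup>T C P\<close> depends only on \<open>z\<close>
  and on the quadratic form of \<open>C\<close> on the complement of \<open>a\<close>. The set \<open>pinned\<close> stores both in one symmetric
  matrix \<open>D\<close>: the form there, and \<open>z\<close> as \<open>a + D a\<close>. It has codimension 2 because \<open>z - a\<close> is orthogonal to \<open>a\<close> and \<open>e\<close>.\<close>

definition pinned :: "real^'n \<Rightarrow> real^'n \<Rightarrow> real^'n \<Rightarrow> (real^'n^'n) set" where
  "pinned x a e = {C \<in> sym_null x. a \<bullet> (C *v a) = 0 \<and> e \<bullet> (C *v a) = 0}"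

lemma subspace_quadratic_0: "subspace {C :: real^'n^'n. u \<bullet> (C *v v) = 0}"
  by (auto simp: subspace_def matrix_vector_mult_add_rdistrib inner_add_right scaleR_matrix_vector_assoc[symmetric])

lemma pinned_eq: "pinned x a e = sym_null x \<inter> {C. a \<bullet> (C *v a) = 0} \<inter> {C. e \<bullet> (C *v a) = 0}"
  by (auto simp: pinned_def)

lemma subspace_pinned: "subspace (pinned x a e)"
  unfolding pinned_eq by (intro subspace_inter subspace_sym_null subspace_quadratic_0)

lemma subspace_dim_less:
  fixes S T :: "'a::euclidean_space set"
  assumes "subspace S" "subspace T" "S \<subseteq> T" "u \<in> T" "u \<notin> S"
  shows "dim S < dim T"
  using assms subspace_dim_equal[of S T] not_le by blast

text \<open>Each of the two conditions costs a dimension: \<open>outer a a\<close> violates the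
  first, and \<open>outer e a + outer a e\<close> satisfies the first but violates the
  second.\<close>

lemma dim_pinned:
  assumes "norm a = 1" "a \<bullet> x = 0" "e \<bullet> x = 0" "a \<bullet> e = 0" "e \<noteq> 0"
  shows "dim (pinned x a e) + 2 \<le> dim (sym_null x)"
proof -
  let ?T = "sym_null x \<inter> {C. a \<bullet> (C *v a) = 0}"
  have aa: "a \<bullet> a = 1" using assms(1) by (simp add: norm_eq_1)
  have subT: "subspace ?T" by (intro subspace_inter subspace_sym_null subspace_quadratic_0)
  have "dim (pinned x a e) < dim ?T"
  proof (rule subspace_dim_less[OF subspace_pinned subT])
    show "outer e a + outer a e \<in> ?T"
      using assms by (simp add: sym_null_def matrix_vector_mult_add_rdistrib inner_add_right inner_commute[of e a])
    show "outer e a + outer a e \<notin> pinned x a e"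
      using assms aa by (simp add: pinned_def matrix_vector_mult_add_rdistrib inner_add_right inner_commute[of e a])
  qed (auto simp: pinned_def)
  moreover have "dim ?T < dim (sym_null x)"
  proof (rule subspace_dim_less[OF subT subspace_sym_null])
    show "outer a a \<in> sym_null x" using assms by (simp add: sym_null_def)
    show "outer a a \<notin> ?T" using aa by simp
  qed auto
  ultimately show ?thesis by linarith
qed

text \<open>The argument plays the role of the stored matrix \<open>D\<close>. With
  \<open>z = a + D a\<close>, the product \<open>(mat 1 + D) ** outer a a\<close> is the matrix
  \<open>z a\<^sup>T\<close>, so the value is \<open>P\<^sup>T D P\<close>. It is polynomial in
  \<open>D\<close>, hence Lipschitz on bounded sets.\<close>

definition pinned_map :: "real^'n \<Rightarrow> real^'n^'n \<Rightarrow> real^'n^'n" where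
  "pinned_map a C =
     transpose (mat 1 - (mat 1 + C) ** outer a a) ** (C ** (mat 1 - (mat 1 + C) ** outer a a))"

lemma pinned_map_sym:
  assumes "C \<in> sym_matrices"
  shows "pinned_map a C \<in> sym_matrices"
  using assms by (simp add: sym_matrices_def pinned_map_def matrix_transpose_mul matrix_mul_assoc)

lemma transpose_mult_inner: "u \<bullet> (transpose A *v v) = (A *v u) \<bullet> (v :: real^'n)"
  by (metis dot_lmul_matrix transpose_matrix_vector transpose_transpose)

lemma pinned_map_inner:
  fixes a :: "real^'n"
  shows "u \<bullet> (pinned_map a C *v v) =
    (u - (a \<bullet> u) *\<^sub>R (a + C *v a)) \<bullet> (C *v (v - (a \<bullet> v) *\<^sub>R (a + C *v a)))"
proof -
  have P: "(mat 1 - (mat 1 + C) ** outer a a) *v w = w - (a \<bullet> w) *\<^sub>R (a + C *v a)" for w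
    by (simp add: matrix_vector_mult_diff_rdistrib matrix_vector_mul_assoc[symmetric] matrix_vector_mult_add_rdistrib
        matrix_vector_mult_scaleR scaleR_add_right)
  show ?thesis
    unfolding pinned_map_def matrix_vector_mul_assoc[symmetric] transpose_mult_inner P ..
qed

lemma in_image_pinned_map:
  fixes C :: "real^'n^'n"
  assumes a: "norm a = 1" "a \<bullet> x = 0" "e \<bullet> x = 0" "a \<bullet> e = 0"
    and C: "C \<in> sym_null x" and z: "C *v z = 0" "x \<bullet> z = 0" "e \<bullet> z = 0" "a \<bullet> z = 1"
  shows "C \<in> pinned_map a ` pinned x a e"
proof -
  have aa: "a \<bullet> a = 1" using a(1) by (simp add: norm_eq_1)
  have sC: "C \<in> sym_matrices" and Cx: "C *v x = 0" using C by (auto simp: sym_null_def)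
  define Q where "Q = mat 1 - outer a a"
  \<comment> \<open>The first summand keeps the form of \<open>C\<close> on the complement of
    \<open>a\<close> and kills \<open>a\<close>. The second contributes \<open>z - a\<close> at
    \<open>a\<close>, because \<open>z - a\<close> is orthogonal to \<open>a\<close>.\<close>
  define D where "D = Q ** (C ** Q) + (outer (z - a) a + outer a (z - a))"
  have Qv: "Q *v v = v - (a \<bullet> v) *\<^sub>R a" for v
    by (simp add: Q_def matrix_vector_mult_diff_rdistrib)
  have tQ: "transpose Q = Q" by (simp add: Q_def transpose_diff)
  have Dv: "D *v v = Q *v (C *v (v - (a \<bullet> v) *\<^sub>R a)) + (a \<bullet> v) *\<^sub>R (z - a) + ((z - a) \<bullet> v) *\<^sub>R a" for v
    by (simp add: D_def matrix_vector_mult_add_rdistrib matrix_vector_mul_assoc[symmetric] Qv)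
  have Da: "D *v a = z - a" using aa z by (simp add: Dv inner_diff_left inner_commute[of z a])
  have "D \<in> sym_matrices"
  proof -
    have "transpose (Q ** (C ** Q)) = Q ** (C ** Q)"
      using sC tQ by (simp add: matrix_transpose_mul sym_matrices_def matrix_mul_assoc)
    then have "Q ** (C ** Q) \<in> sym_matrices" by (simp add: sym_matrices_def)
    then show ?thesis unfolding D_def by (intro subspace_add subspace_sym_matrices outer_add_outer_sym)
  qed
  moreover have "D *v x = 0"
    using a z Cx by (simp add: Dv Qv inner_diff_left inner_commute[of z x])
  ultimately have "D \<in> pinned x a e"
    using a z aa by (simp add: pinned_def sym_null_def Da inner_diff_right inner_commute[of e a])
  moreover have "pinned_map a D = C"
  proof -
    have "u \<bullet> (pinned_map a D *v v) = u \<bullet> (C *v v)" for u v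
    proof -
      \<comment> \<open>The projection along \<open>z\<close> lands in the complement of
        \<open>a\<close>, where \<open>D\<close> and \<open>C\<close> have the same form, and it
        does not change \<open>C *v w\<close> because \<open>z\<close> is in the kernel.\<close>
      define p where "p w = w - (a \<bullet> w) *\<^sub>R z" for w
      have ap: "a \<bullet> p w = 0" for w using z by (simp add: p_def inner_diff_right)
      have Cp: "C *v p w = C *v w" for w
        by (simp add: p_def matrix_vector_mult_diff_distrib matrix_vector_mult_scaleR z)
      have "u \<bullet> (pinned_map a D *v v) = p u \<bullet> (D *v p v)"
        by (simp add: pinned_map_inner Da p_def)
      also have "\<dots> = p u \<bullet> (C *v p v)"
        using ap[of u] by (simp add: Dv ap Qv inner_add_right inner_diff_right inner_commute[of "p u" a])
      also have "\<dots> = v \<bullet> (C *v p u)" unfolding Cp by (rule sym_dot_swap[OF sC, symmetric, THEN trans]) (simp add: Cp)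
      also have "\<dots> = u \<bullet> (C *v v)" unfolding Cp by (rule sym_dot_swap[OF sC])
      finally show ?thesis .
    qed
    then have "pinned_map a D *v v = C *v v" for v
      by (metis vector_eq_ldot)
    then show ?thesis by (simp add: matrix_eq)
  qed
  ultimately show ?thesis by blast
qed

section \<open>Lipschitz bounds for matrix products on bounded sets\<close>

lemma lipschitz_on_bounded_bilinear:
  assumes h: "bounded_bilinear h" and f: "K-lipschitz_on S f" and g: "L-lipschitz_on S g"
    and "bounded (f ` S)" "bounded (g ` S)"
  shows "\<exists>M. M-lipschitz_on S (\<lambda>x. h (f x) (g x))"
proof -
  interpret bounded_bilinear h by (rule h)
  obtain B where B: "B > 0" "\<And>a b. norm (h a b) \<le> norm a * norm b * B" using pos_bounded by blast
  obtain F where F: "F > 0" "\<And>x. x \<in> S \<Longrightarrow> norm (f x) \<le> F"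
    using assms(4) unfolding bounded_pos by auto
  obtain G where G: "G > 0" "\<And>x. x \<in> S \<Longrightarrow> norm (g x) \<le> G"
    using assms(5) unfolding bounded_pos by auto
  have K: "K \<ge> 0" and L: "L \<ge> 0" using f g lipschitz_on_nonneg by auto
  have "(K * G * B + F * L * B)-lipschitz_on S (\<lambda>x. h (f x) (g x))"
  proof (rule lipschitz_onI)
    fix u v assume u: "u \<in> S" and v: "v \<in> S"
    \<comment> \<open>Changing one factor at a time pairs each Lipschitz increment with a bounded
      factor.\<close>
    have "dist (h (f u) (g u)) (h (f v) (g v)) = norm (h (f u - f v) (g u) + h (f v) (g u - g v))"
      by (simp add: dist_norm diff_left diff_right)
    also have "\<dots> \<le> norm (h (f u - f v) (g u)) + norm (h (f v) (g u - g v))" by (rule norm_triangle_ineq)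
    also have "\<dots> \<le> norm (f u - f v) * norm (g u) * B + norm (f v) * norm (g u - g v) * B"
      using B(2) by (intro add_mono)
    also have "\<dots> \<le> (K * dist u v) * G * B + F * (L * dist u v) * B"
      using lipschitz_onD[OF f u v] lipschitz_onD[OF g u v] F(2)[OF v] G(2)[OF u] B(1) K F(1)
      by (intro add_mono mult_mono mult_right_mono) (auto simp: dist_norm)
    finally show "dist (h (f u) (g u)) (h (f v) (g v)) \<le> (K * G * B + F * L * B) * dist u v"
      by (simp add: algebra_simps)
  qed (use K L F(1) G(1) B(1) in simp)
  then show ?thesis ..
qed

lemma bounded_lipschitz_image:
  assumes "K-lipschitz_on S f" "bounded S"
  shows "bounded (f ` S)"
proof -
  obtain e where e: "\<And>u v. u \<in> S \<Longrightarrow> v \<in> S \<Longrightarrow> dist u v \<le> e"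
    using assms(2) unfolding bounded_two_points by blast
  have "dist (f u) (f v) \<le> K * e" if "u \<in> S" "v \<in> S" for u v
    using lipschitz_onD[OF assms(1) that] mult_left_mono[OF e[OF that] lipschitz_on_nonneg[OF assms(1)]] by linarith
  then show ?thesis unfolding bounded_two_points by blast
qed

lemma bounded_bilinear_matrix_matrix_mult:
  "bounded_bilinear ((**) :: real^'n^'m \<Rightarrow> real^'p^'n \<Rightarrow> real^'p^'m)"
  unfolding bilinear_conv_bounded_bilinear[symmetric] bilinear_def
  by (auto intro!: linearI simp: matrix_matrix_mult_def vec_eq_iff sum.distrib sum_distrib_left algebra_simps)

lemma lipschitz_on_matrix_matrix_mult:
  fixes f :: "'a::metric_space \<Rightarrow> real^'n^'m" and g :: "'a \<Rightarrow> real^'p^'n"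
  assumes "bounded S" "\<exists>K. K-lipschitz_on S f" "\<exists>L. L-lipschitz_on S g"
  shows "\<exists>M. M-lipschitz_on S (\<lambda>x. f x ** g x)"
proof -
  obtain K L where "K-lipschitz_on S f" "L-lipschitz_on S g" using assms by blast
  then show ?thesis
    using assms(1) by (intro lipschitz_on_bounded_bilinear[OF bounded_bilinear_matrix_matrix_mult] bounded_lipschitz_image)
qed

lemma pinned_map_lipschitz:
  fixes a :: "real^'n"
  assumes S: "bounded S"
  shows "\<exists>K. K-lipschitz_on S (pinned_map a)"
proof -
  have id: "\<exists>K. K-lipschitz_on S (\<lambda>C. C)" using lipschitz_on_id by blast
  have const: "\<exists>K. K-lipschitz_on S (\<lambda>C. D)" for D :: "real^'n^'n" using lipschitz_on_constant by blast
  have "\<exists>K. K-lipschitz_on S (\<lambda>C. mat 1 + C)"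
    by (rule exI, rule lipschitz_on_add[OF lipschitz_on_constant lipschitz_on_id])
  from lipschitz_on_matrix_matrix_mult[OF S this const]
  obtain L where "L-lipschitz_on S (\<lambda>C. (mat 1 + C) ** outer a a)" ..
  from lipschitz_on_diff[OF lipschitz_on_constant this]
  obtain K where K: "K-lipschitz_on S (\<lambda>C. mat 1 - (mat 1 + C) ** outer a a)" (is "K-lipschitz_on S ?P") ..
  \<comment> \<open>Transposition is an isometry, so the transposed factor keeps its Lipschitz
    constant.\<close>
  have norm_transpose: "norm (transpose A) = norm A" for A :: "real^'n^'n"
    unfolding norm_eq_sqrt_inner by (simp add: inner_vec_def transpose_def) (rule sum.swap)
  have "K-lipschitz_on S (\<lambda>C. transpose (?P C))"
    using K unfolding lipschitz_on_def dist_norm transpose_diff[symmetric] norm_transpose .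
  then show ?thesis unfolding pinned_map_def
    using K by (intro lipschitz_on_matrix_matrix_mult S id exI)
qed

section \<open>Null sets of matrices with additional kernel vectors\<close>

lemma hausdorff_measure_0_kernel_pinned:
  fixes x :: "real^'n"
  assumes "norm a = 1" "a \<bullet> x = 0" "e \<bullet> x = 0" "a \<bullet> e = 0" "e \<noteq> 0" "x \<noteq> 0"
  shows "hausdorff_measure sym_matrices (dim (sym_null_hyperplane x))
    {C \<in> sym_null x. \<exists>z. C *v z = 0 \<and> x \<bullet> z = 0 \<and> e \<bullet> z = 0 \<and> a \<bullet> z = 1} = 0"
proof (rule hausdorff_measure_0_subset)
  show "{C \<in> sym_null x. \<exists>z. C *v z = 0 \<and> x \<bullet> z = 0 \<and> e \<bullet> z = 0 \<and> a \<bullet> z = 1} \<subseteq> pinned_map a ` pinned x a e"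
    using in_image_pinned_map[OF assms(1-4)] by auto
  show "hausdorff_measure sym_matrices (dim (sym_null_hyperplane x)) (pinned_map a ` pinned x a e) = 0"
  proof (rule hausdorff_measure_0_image_subspace[OF subspace_pinned])
    \<comment> \<open>Compared with \<open>sym_null x\<close>, the pinned subspace loses at least
      two dimensions and the hyperplane at most one.\<close>
    show "real (dim (pinned x a e)) < real (dim (sym_null_hyperplane x))"
      using dim_pinned[of a x e] dim_sym_null_le[of x] assms by simp
    show "pinned_map a ` pinned x a e \<subseteq> sym_matrices"
      using pinned_map_sym by (auto simp: pinned_def sym_null_def)
    fix r
    have "bounded (pinned x a e \<inter> cball 0 r)" by (simp add: bounded_Int)
    from pinned_map_lipschitz[OF this, of a]
    show "\<exists>K. \<forall>u\<in>pinned x a e \<inter> cball 0 r. \<forall>v\<in>pinned x a e \<inter> cball 0 r.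
           dist (pinned_map a u) (pinned_map a v) \<le> K * dist u v"
      unfolding lipschitz_on_def by blast
  qed
qed

text \<open>A nonzero \<open>z\<close> orthogonal to \<open>x\<close> and \<open>e\<close> is not
  orthogonal to every vector of an orthonormal basis of their complement. Rescaling it to
  \<open>b \<bullet> z = 1\<close> for a suitable basis vector \<open>b\<close> reduces the claim to
  finitely many pinned sets.\<close>

lemma hausdorff_measure_0_kernel_perp:
  fixes x :: "real^'n"
  assumes "e \<bullet> x = 0" "e \<noteq> 0" "x \<noteq> 0"
  shows "hausdorff_measure sym_matrices (dim (sym_null_hyperplane x))
    {C \<in> sym_null x. \<exists>z. z \<noteq> 0 \<and> C *v z = 0 \<and> x \<bullet> z = 0 \<and> e \<bullet> z = 0} = 0"
proof -
  have sub: "subspace {v. x \<bullet> v = 0 \<and> e \<bullet> v = 0}"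
    by (auto simp: subspace_def inner_add_right)
  obtain B where B: "B \<subseteq> {v. x \<bullet> v = 0 \<and> e \<bullet> v = 0}" "\<And>b. b \<in> B \<Longrightarrow> norm b = 1"
    "independent B" "span B = {v. x \<bullet> v = 0 \<and> e \<bullet> v = 0}"
    by (rule orthonormal_basis_subspace[OF sub]) blast
  show ?thesis
  proof (rule hausdorff_measure_0_subset)
    show "hausdorff_measure sym_matrices (dim (sym_null_hyperplane x))
      (\<Union>b\<in>B. {C \<in> sym_null x. \<exists>z. C *v z = 0 \<and> x \<bullet> z = 0 \<and> e \<bullet> z = 0 \<and> b \<bullet> z = 1}) = 0"
      using B assms
      by (intro hausdorff_measure_0_UN hausdorff_measure_0_kernel_pinned)
        (auto simp: inner_commute countable_finite independent_imp_finite)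
    show "{C \<in> sym_null x. \<exists>z. z \<noteq> 0 \<and> C *v z = 0 \<and> x \<bullet> z = 0 \<and> e \<bullet> z = 0}
      \<subseteq> (\<Union>b\<in>B. {C \<in> sym_null x. \<exists>z. C *v z = 0 \<and> x \<bullet> z = 0 \<and> e \<bullet> z = 0 \<and> b \<bullet> z = 1})"
    proof
      fix C assume "C \<in> {C \<in> sym_null x. \<exists>z. z \<noteq> 0 \<and> C *v z = 0 \<and> x \<bullet> z = 0 \<and> e \<bullet> z = 0}"
      then obtain z where C: "C \<in> sym_null x" and z: "z \<noteq> 0" "C *v z = 0" "x \<bullet> z = 0" "e \<bullet> z = 0" by blast
      have "\<exists>b\<in>B. b \<bullet> z \<noteq> 0"
      proof (rule ccontr)
        assume "\<not> ?thesis"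
        then have "\<And>b. b \<in> B \<Longrightarrow> orthogonal z b" by (auto simp: orthogonal_def inner_commute)
        moreover have "z \<in> span B" using B(4) z by simp
        ultimately have "orthogonal z z" using orthogonal_to_span by metis
        then show False using z by (simp add: orthogonal_def)
      qed
      then obtain b where b: "b \<in> B" "b \<bullet> z \<noteq> 0" by blast
      let ?z = "(1 / (b \<bullet> z)) *\<^sub>R z"
      have "C *v ?z = 0 \<and> x \<bullet> ?z = 0 \<and> e \<bullet> ?z = 0 \<and> b \<bullet> ?z = 1"
        using z b by (simp add: matrix_vector_mult_scaleR)
      then show "C \<in> (\<Union>b\<in>B. {C \<in> sym_null x. \<exists>z. C *v z = 0 \<and> x \<bullet> z = 0 \<and> e \<bullet> z = 0 \<and> b \<bullet> z = 1})"
        using C b by blast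
    qed
  qed
qed

text \<open>The normalized part \<open>a\<close> of \<open>y\<close> orthogonal to \<open>x\<close>
  is again in the kernel, so \<open>z = a\<close> meets the pinning conditions. Dimension at least 3
  leaves room for \<open>e\<close> orthogonal to both \<open>x\<close> and \<open>a\<close>.\<close>

lemma hausdorff_measure_0_kernel_vector:
  fixes x y :: "real^'n"
  assumes n: "CARD('n) \<ge> 3" and x: "x \<noteq> 0" and y: "\<And>k. y \<noteq> k *\<^sub>R x"
  shows "hausdorff_measure sym_matrices (dim (sym_null_hyperplane x)) {C \<in> sym_null x. C *v y = 0} = 0"
proof -
  define w where "w = y - ((x \<bullet> y) / (x \<bullet> x)) *\<^sub>R x"
  define a where "a = w /\<^sub>R norm w"
  have "w \<noteq> 0" using y by (simp add: w_def)
  then have a: "norm a = 1" by (simp add: a_def)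
  have ax: "a \<bullet> x = 0" using x by (simp add: a_def w_def inner_diff_left inner_commute[of y x])
  have "dim {x, a} \<le> card {x, a}" by (rule dim_le_card') simp
  also have "\<dots> \<le> 2" by (simp add: card_insert_if)
  also have "\<dots> < DIM(real^'n)" using n by simp
  finally obtain e where e: "e \<noteq> 0" "\<And>y. y \<in> span {x, a} \<Longrightarrow> orthogonal e y"
    using orthogonal_to_subspace_exists by blast
  then have ex: "e \<bullet> x = 0" "e \<bullet> a = 0" by (auto simp: orthogonal_def span_base)
  show ?thesis
  proof (rule hausdorff_measure_0_subset)
    show "hausdorff_measure sym_matrices (dim (sym_null_hyperplane x))
      {C \<in> sym_null x. \<exists>z. C *v z = 0 \<and> x \<bullet> z = 0 \<and> e \<bullet> z = 0 \<and> a \<bullet> z = 1} = 0"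
      using a ax e(1) ex x by (intro hausdorff_measure_0_kernel_pinned) (auto simp: inner_commute)
    have "C *v a = 0" if "C \<in> sym_null x" "C *v y = 0" for C
      using that by (simp add: a_def w_def sym_null_def matrix_vector_mult_scaleR matrix_vector_mult_diff_distrib)
    then show "{C \<in> sym_null x. C *v y = 0}
      \<subseteq> {C \<in> sym_null x. \<exists>z. C *v z = 0 \<and> x \<bullet> z = 0 \<and> e \<bullet> z = 0 \<and> a \<bullet> z = 1}"
      using a ax ex by (auto intro!: exI[of _ a] simp: inner_commute norm_eq_1)
  qed
qed

section \<open>Strict complementarity\<close>

text \<open>The dual optimum is unique: comparison with the feasible \<open>y = 0\<close> and
  testing \<open>S\<close> at \<open>x\<close> force \<open>1 \<bullet> y = 0\<close>, hence
  \<open>S *v x = 0\<close> and \<open>y = 0\<close>. So \<open>S = C\<close>, and complementarity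
  puts the range of \<open>X\<close> into the kernel of \<open>C\<close>.\<close>

lemma strict_complementarity_face:
  fixes x :: "real^'n"
  assumes x: "\<And>i. \<bar>x $ i\<bar> = 1" and C: "C \<in> psd_null x" and sc: "strict_complementarity (- C)"
  obtains X where "X \<in> elliptope" "\<And>v. C *v (X *v v) = 0" "X + C \<in> pos_def_matrices"
proof -
  obtain X y S where X: "primal_optimal (- C) X" and S: "dual_optimal (- C) (y, S)"
    and XS: "X ** S = 0" "X + S \<in> pos_def_matrices"
    using sc unfolding strict_complementarity_def by blast
  have Cx: "C *v x = 0" and psdC: "C \<in> psd_matrices" using C by (auto simp: psd_null_def)
  have Sy: "S = Diag y + C" and psdS: "S \<in> psd_matrices"
    and min: "\<And>y' S'. S' = Diag y' + C \<Longrightarrow> S' \<in> psd_matrices \<Longrightarrow> \<not> 1 \<bullet> y' < 1 \<bullet> y"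
    using S by (auto simp: dual_optimal_def is_arg_min_def)
  have D0: "Diag 0 = (0 :: real^'n^'n)" by (simp add: Diag_def vec_eq_iff)
  have "1 \<bullet> y \<le> 0" using min[of C 0] psdC by (simp add: D0)
  have Dy: "Diag y *v v = (\<chi> i. y $ i * v $ i)" for v
    by (simp add: Diag_def matrix_vector_mult_def vec_eq_iff if_distrib[of "\<lambda>a. a * _"] cong: if_cong)
  have xx: "x $ i * x $ i = 1" for i using x[of i] by (auto simp: abs_if split: if_splits)
  have Sx: "S *v x = (\<chi> i. y $ i * x $ i)"
    using Cx by (simp add: Sy matrix_vector_mult_add_rdistrib Dy)
  have "x \<bullet> (S *v x) = 1 \<bullet> y"
    unfolding Sx inner_vec_def by (intro sum.cong refl) (use xx in \<open>simp add: algebra_simps\<close>)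
  then have "x \<bullet> (S *v x) = 0" using \<open>1 \<bullet> y \<le> 0\<close> psd_nonneg[OF psdS, of x] by linarith
  then have "S *v x = 0" by (rule psd_mult_eq_0[OF psdS])
  then have "y $ i * x $ i = 0" for i unfolding Sx by (simp add: vec_eq_iff)
  then have "y = 0" using xx by (auto simp: vec_eq_iff) (metis mult_zero_right zero_neq_one)
  then have SC: "S = C" using Sy D0 by simp
  show ?thesis
  proof
    show elX: "X \<in> elliptope" using X by (simp add: primal_optimal_def is_arg_max_def)
    show "X + C \<in> pos_def_matrices" using XS SC by simp
    have "transpose (X ** C) = 0" using XS SC by (simp add: transpose_def vec_eq_iff)
    then have "C ** X = 0"
      using psd_sym[OF psdC] psd_sym[OF elliptope_psd[OF elX]] by (simp add: matrix_transpose_mul sym_matrices_def)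
    then show "C *v (X *v v) = 0" for v by (simp add: matrix_vector_mul_assoc)
  qed
qed

text \<open>The diagonal of \<^term>\<open>X\<close> is a nondegenerate quadratic polynomial in the numbers
  \<^term>\<open>x $ i * z $ i\<close>, so these numbers take at most two values.\<close>

lemma kernel_contains_restriction:
  fixes x z :: "real^'n"
  assumes x: "\<And>i. \<bar>x $ i\<bar> = 1" and C: "C \<in> psd_null x"
    and X: "X \<in> elliptope" "\<And>v. C *v (X *v v) = 0" "X + C \<in> pos_def_matrices"
    and z: "z \<noteq> 0" "x \<bullet> z = 0" "C *v z = 0"
    and ker: "\<And>v. x \<bullet> v = 0 \<Longrightarrow> C *v v = 0 \<Longrightarrow> \<exists>k. v = k *\<^sub>R z"
  shows "\<exists>A. A \<noteq> {} \<and> A \<noteq> UNIV \<and> C *v (\<chi> i. if i \<in> A then x $ i else 0) = 0"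
proof -
  have xx: "x $ i * x $ i = 1" for i using x[of i] by (auto simp: abs_if split: if_splits)
  have x0: "x \<noteq> 0" using xx by (metis mult_zero_left zero_index zero_neq_one)
  have Cx: "C *v x = 0" using C by (simp add: psd_null_def)
  have sX: "X \<in> sym_matrices" using X(1) by (intro psd_sym elliptope_psd)
  define \<alpha> where "\<alpha> v = (x \<bullet> (X *v v)) / (x \<bullet> x)" for v
  define \<beta> where "\<beta> v = (z \<bullet> (X *v v)) / (z \<bullet> z)" for v
  \<comment> \<open>The kernel of \<open>C\<close> is spanned by the orthogonal vectors
    \<open>x\<close> and \<open>z\<close>, and it contains the range of \<open>X\<close>.\<close>
  have Xv: "X *v v = \<alpha> v *\<^sub>R x + \<beta> v *\<^sub>R z" for v
  proof -
    have "x \<bullet> (X *v v - \<alpha> v *\<^sub>R x) = 0" using x0 by (simp add: \<alpha>_def inner_diff_right)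
    moreover have "C *v (X *v v - \<alpha> v *\<^sub>R x) = 0"
      using X(2) Cx by (simp add: matrix_vector_mult_diff_distrib matrix_vector_mult_scaleR)
    ultimately obtain k where k: "X *v v - \<alpha> v *\<^sub>R x = k *\<^sub>R z" using ker by blast
    then have "X *v v = \<alpha> v *\<^sub>R x + k *\<^sub>R z" by (simp add: algebra_simps)
    moreover from this have "\<beta> v = k" using z by (simp add: \<beta>_def inner_add_right inner_commute[of z x])
    ultimately show ?thesis by simp
  qed
  define a b c where "a = \<alpha> x / (x \<bullet> x)" and "b = \<beta> x / (x \<bullet> x) + \<alpha> z / (z \<bullet> z)" and "c = \<beta> z / (z \<bullet> z)"
  have "0 < z \<bullet> ((X + C) *v z)" using X(3) z by (simp add: pos_def_matrices_def)
  \<comment> \<open>As \<open>C *v z = 0\<close>, definiteness of \<open>X + C\<close> at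
    \<open>z\<close> falls on \<open>X\<close> alone and makes the leading coefficient
    positive.\<close>
  then have c: "c > 0"
    using z by (simp add: c_def \<beta>_def matrix_vector_mult_add_rdistrib)
  have quad: "a + b * (x $ i * z $ i) + c * (x $ i * z $ i)\<^sup>2 = 1" for i
  proof -
    let ?e = "axis i (1::real)"
    have "v \<bullet> (X *v ?e) = \<alpha> v * x $ i + \<beta> v * z $ i" for v
      using sym_dot_swap[OF sX, of v ?e] arg_cong[OF Xv[of v], of "\<lambda>u. ?e \<bullet> u"]
      by (simp add: inner_axis')
    then have "\<alpha> ?e = (\<alpha> x * x $ i + \<beta> x * z $ i) / (x \<bullet> x)" "\<beta> ?e = (\<alpha> z * x $ i + \<beta> z * z $ i) / (z \<bullet> z)"
      unfolding \<alpha>_def[of ?e] \<beta>_def[of ?e] by simp_all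
    then have "X $ i $ i = (\<alpha> x * x $ i + \<beta> x * z $ i) / (x \<bullet> x) * x $ i + (\<alpha> z * x $ i + \<beta> z * z $ i) / (z \<bullet> z) * z $ i"
      using axis_mult_axis[of i X i] Xv[of ?e] by (simp add: inner_add_right inner_axis')
    also have "\<dots> = a * (x $ i * x $ i) + b * (x $ i * z $ i) + c * (z $ i * z $ i)"
      by (simp add: a_def b_def c_def add_divide_distrib algebra_simps)
    also have "z $ i * z $ i = (x $ i * z $ i)\<^sup>2"
      using xx[of i] by (simp add: power2_eq_square mult.left_commute mult.assoc)
    finally show ?thesis using xx elliptope_diag[OF X(1)] by simp
  qed
  define w where "w i = x $ i * z $ i" for i
  define j :: 'n where "j = undefined"
  define A where "A = {i. w i = w j}"
  have zw: "z $ i = w i * x $ i" for i using xx[of i] by (simp add: w_def mult.assoc mult.left_commute mult.commute)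
  have "A \<noteq> UNIV"
  proof
    assume "A = UNIV"
    then have "w i = w j" for i by (auto simp: A_def)
    then have "z = w j *\<^sub>R x" using zw by (simp add: vec_eq_iff)
    then show False using z x0 by auto
  qed
  then obtain k where k: "w k \<noteq> w j" by (auto simp: A_def)
  \<comment> \<open>Any root different from \<open>w j\<close> is determined by the sum of the
    roots, \<open>- b / c\<close>.\<close>
  have two: "w i = w k" if "w i \<noteq> w j" for i
  proof -
    have *: "c * (w l + w j) + b = 0" if "w l \<noteq> w j" for l
    proof -
      have "(w l - w j) * (c * (w l + w j) + b) = 0"
        using quad[of l] quad[of j] by (simp add: w_def[symmetric] power2_eq_square algebra_simps)
      then show ?thesis using that by simp
    qed
    have "c * (w i + w j) = c * (w k + w j)" using *[OF that] *[OF k] by linarith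
    then show ?thesis using c by simp
  qed
  \<comment> \<open>Linear interpolation between the two values of \<open>w\<close> writes the
    restriction of \<open>x\<close> as a combination of the kernel vectors \<open>z\<close> and
    \<open>x\<close>.\<close>
  have "(\<chi> i. if i \<in> A then x $ i else 0) = (1 / (w j - w k)) *\<^sub>R (z - w k *\<^sub>R x)"
  proof -
    have "(if i \<in> A then x $ i else 0) = (1 / (w j - w k)) * (z $ i - w k * x $ i)" for i
    proof (cases "i \<in> A")
      case True
      then have "z $ i - w k * x $ i = (w j - w k) * x $ i" using zw[of i] by (simp add: A_def algebra_simps)
      then show ?thesis using True k by simp
    next
      case False
      then show ?thesis using two[of i] zw[of i] by (simp add: A_def)
    qed
    then show ?thesis by (simp add: vec_eq_iff)
  qed
  then have "C *v (\<chi> i. if i \<in> A then x $ i else 0) = 0"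
    using z Cx by (simp add: matrix_vector_mult_scaleR matrix_vector_mult_diff_distrib)
  moreover have "A \<noteq> {}" by (auto simp: A_def)
  ultimately show ?thesis using \<open>A \<noteq> UNIV\<close> by blast
qed

text \<open>If the first alternative fails, a kernel vector orthogonal to \<open>x\<close> is
  determined by its inner product with \<open>e\<close>. Such vectors then form the line through
  \<open>z\<close>, as \<open>kernel_contains_restriction\<close> requires.\<close>

lemma strict_complementarity_cases:
  fixes x e :: "real^'n"
  assumes x: "\<And>i. \<bar>x $ i\<bar> = 1" and C: "C \<in> psd_null x" and sc: "strict_complementarity (- C)"
    and z: "z \<noteq> 0" "x \<bullet> z = 0" "C *v z = 0"
  shows "(\<exists>v. v \<noteq> 0 \<and> C *v v = 0 \<and> x \<bullet> v = 0 \<and> e \<bullet> v = 0) \<or>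
    (\<exists>A. A \<noteq> {} \<and> A \<noteq> UNIV \<and> C *v (\<chi> i. if i \<in> A then x $ i else 0) = 0)"
proof (cases "\<exists>v. v \<noteq> 0 \<and> C *v v = 0 \<and> x \<bullet> v = 0 \<and> e \<bullet> v = 0")
  case False
  then have ez: "e \<bullet> z \<noteq> 0" using z by blast
  have "v = ((e \<bullet> v) / (e \<bullet> z)) *\<^sub>R z" if "x \<bullet> v = 0" "C *v v = 0" for v
  proof -
    let ?u = "v - ((e \<bullet> v) / (e \<bullet> z)) *\<^sub>R z"
    have "C *v ?u = 0" "x \<bullet> ?u = 0" "e \<bullet> ?u = 0"
      using that z ez by (simp_all add: matrix_vector_mult_diff_distrib matrix_vector_mult_scaleR inner_diff_right)
    then have "?u = 0" using False by blast
    then show ?thesis by simp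
  qed
  then have ker: "\<And>v. x \<bullet> v = 0 \<Longrightarrow> C *v v = 0 \<Longrightarrow> \<exists>k. v = k *\<^sub>R z" by blast
  obtain X where "X \<in> elliptope" "\<And>v. C *v (X *v v) = 0" "X + C \<in> pos_def_matrices"
    using strict_complementarity_face[OF x C sc] by blast
  from kernel_contains_restriction[OF x C this z ker] show ?thesis by blast
qed blast

section \<open>Lower bound for the Hausdorff dimension of the relative frontier\<close>

lemma hausdorff_dim_rel_frontier_psd_null:
  fixes x :: "real^'n"
  assumes n: "CARD('n) \<ge> 2" and x: "x \<noteq> 0" and d: "dim (sym_null_hyperplane x) > 0"
  shows "real (dim (sym_null_hyperplane x)) \<le> hausdorff_dim sym_matrices (rel_frontier (psd_null x))"
proof -
  let ?J = "perp_proj x"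
  define f where "f C = C - ((?J \<bullet> C) / (?J \<bullet> ?J)) *\<^sub>R ?J" for C
  show ?thesis
  proof (rule hausdorff_dim_ge_subspace_image[OF subspace_sym_null_hyperplane d])
    show "linear f"
      by (auto intro!: linearI simp: f_def inner_add_right add_divide_distrib algebra_simps)
    show "rel_frontier (psd_null x) \<subseteq> sym_matrices"
      unfolding rel_frontier_psd_null[OF n x] by (auto simp: psd_null_def psd_sym)
    show "subspace (sym_matrices :: (real^'n^'n) set)" by (rule subspace_sym_matrices)
    show "sym_null_hyperplane x \<subseteq> f ` rel_frontier (psd_null x)"
    proof
      fix Y assume Y: "Y \<in> sym_null_hyperplane x"
      then have Yn: "Y \<in> sym_null x" and JY: "?J \<bullet> Y = 0" by (auto simp: sym_null_hyperplane_def)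
      obtain z where z: "norm z = 1" "x \<bullet> z = 0"
        and zmin: "\<And>w. x \<bullet> w = 0 \<Longrightarrow> (z \<bullet> (Y *v z)) * (w \<bullet> w) \<le> w \<bullet> (Y *v w)"
        using quadratic_form_min_on_perp[OF n] by blast
      have zz: "z \<bullet> z = 1" using z(1) by (simp add: norm_eq_1)
      \<comment> \<open>Subtracting the least Rayleigh quotient makes the form nonnegative and puts
        the minimizer \<open>z\<close> into the kernel.\<close>
      define C where "C = Y - (z \<bullet> (Y *v z)) *\<^sub>R ?J"
      have Cw: "w \<bullet> (C *v w) = w \<bullet> (Y *v w) - (z \<bullet> (Y *v z)) * (w \<bullet> w)" if "x \<bullet> w = 0" for w
        using that by (simp add: C_def matrix_vector_mult_diff_rdistrib scaleR_matrix_vector_assoc[symmetric]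
            perp_proj_mult inner_diff_right)
      have "C \<in> psd_null x"
      proof (rule sym_null_psd_nullI[OF _ x])
        show "C \<in> sym_null x" unfolding C_def
          by (intro subspace_diff subspace_scale subspace_sym_null Yn perp_proj_sym_null x)
      qed (use Cw zmin in simp)
      moreover from this have "C *v z = 0"
        using psd_mult_eq_0[of C z] Cw[OF z(2)] zz by (simp add: psd_null_def)
      moreover have "z \<noteq> 0" using z by auto
      ultimately have "C \<in> rel_frontier (psd_null x)"
        unfolding rel_frontier_psd_null[OF n x] using z by blast
      \<comment> \<open>With \<open>?J\<close> nonzero the quotient in \<open>f\<close> is a true
        division, so \<open>f\<close> removes exactly the multiple of \<open>?J\<close> that was
        subtracted.\<close>
      moreover have "?J \<noteq> 0"
      proof
        assume "?J = 0"
        then have "?J *v z = 0" by simp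
        then show False using z by (simp add: perp_proj_mult)
      qed
      then have "f C = Y" using JY by (simp add: f_def C_def inner_diff_right)
      ultimately show "Y \<in> f ` rel_frontier (psd_null x)" by blast
    qed
  qed
qed

theorem theorem19:
  fixes Xbar :: "real^'n^'n"
  assumes "CARD('n) \<ge> 3"
    and "is_vertex sym_matrices elliptope Xbar"
  shows "fails_generically sym_matrices
           (rel_frontier (psd_matrices \<inter> trace_perp Xbar))
           (\<lambda>C. strict_complementarity (- C))"
proof -
  obtain x where x: "\<And>i. \<bar>x $ i\<bar> = 1" and Xbar: "Xbar = outer x x"
    using elliptope_vertex_rank_one[OF assms(2)] by blast
  have n: "CARD('n) \<ge> 2" using assms(1) by simp
  have x0: "x \<noteq> 0" using x by (metis abs_zero zero_index zero_neq_one)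
  let ?d = "real (dim (sym_null_hyperplane x))"
  let ?r = "\<lambda>A. (\<chi> i. if i \<in> A then x $ i else 0) :: real^'n"
  \<comment> \<open>The auxiliary direction is fixed once, before any \<open>C\<close>, so that
    \<open>N1\<close> is a single null set.\<close>
  obtain e where e: "e \<noteq> 0" "e \<bullet> x = 0"
    using orthogonal_to_vector_exists[of x] n by (auto simp: orthogonal_def inner_commute)
  define N1 where "N1 = {C \<in> sym_null x. \<exists>z. z \<noteq> 0 \<and> C *v z = 0 \<and> x \<bullet> z = 0 \<and> e \<bullet> z = 0}"
  define N2 where "N2 A = {C \<in> sym_null x. C *v ?r A = 0}" for A
  have "hausdorff_measure sym_matrices ?d (N1 \<union> (\<Union>A\<in>{A. A \<noteq> {} \<and> A \<noteq> UNIV}. N2 A)) = 0"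
  proof -
    have 1: "hausdorff_measure sym_matrices ?d N1 = 0"
      unfolding N1_def using e x0 by (intro hausdorff_measure_0_kernel_perp)
    have "hausdorff_measure sym_matrices ?d (N2 A) = 0" if A: "A \<in> {A. A \<noteq> {} \<and> A \<noteq> UNIV}" for A
      unfolding N2_def
    proof (rule hausdorff_measure_0_kernel_vector[OF assms(1) x0])
      fix k
      \<comment> \<open>The entries of \<open>x\<close> are all nonzero, while its restriction
        vanishes outside \<open>A\<close> but not on \<open>A\<close>; so the two vectors are not
        proportional.\<close>
      obtain i j where ij: "i \<in> A" "j \<notin> A" using A by blast
      have "x $ i \<noteq> 0" "x $ j \<noteq> 0" using x[of i] x[of j] by auto
      show "?r A \<noteq> k *\<^sub>R x"
      proof
        assume eq: "?r A = k *\<^sub>R x"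
        have "k * x $ j = 0" using arg_cong[OF eq, of "\<lambda>v. v $ j"] ij by simp
        moreover have "k * x $ i = x $ i" using arg_cong[OF eq, of "\<lambda>v. v $ i"] ij by simp
        ultimately show False using \<open>x $ i \<noteq> 0\<close> \<open>x $ j \<noteq> 0\<close> by simp
      qed
    qed
    then have 2: "hausdorff_measure sym_matrices ?d (\<Union>A\<in>{A. A \<noteq> {} \<and> A \<noteq> UNIV}. N2 A) = 0"
      by (intro hausdorff_measure_0_UN countable_finite) auto
    show ?thesis
      using hausdorff_measure_0_UN[of "UNIV :: bool set" sym_matrices ?d
          "\<lambda>b. if b then N1 else (\<Union>A\<in>{A. A \<noteq> {} \<and> A \<noteq> UNIV}. N2 A)"] 1 2
      by (simp add: UNIV_bool Un_commute)
  qed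
  moreover have "{C \<in> rel_frontier (psd_null x). strict_complementarity (- C)}
      \<subseteq> N1 \<union> (\<Union>A\<in>{A. A \<noteq> {} \<and> A \<noteq> UNIV}. N2 A)"
  proof
    fix C assume "C \<in> {C \<in> rel_frontier (psd_null x). strict_complementarity (- C)}"
    then obtain z where C: "C \<in> psd_null x" and z: "z \<noteq> 0" "x \<bullet> z = 0" "C *v z = 0"
      and sc: "strict_complementarity (- C)"
      unfolding rel_frontier_psd_null[OF n x0] by blast
    have "C \<in> sym_null x" using C by (rule psd_null_sym_null)
    then show "C \<in> N1 \<union> (\<Union>A\<in>{A. A \<noteq> {} \<and> A \<noteq> UNIV}. N2 A)"
      using strict_complementarity_cases[OF x C sc z, of e] unfolding N1_def N2_def by blast
  qed
  ultimately have null: "hausdorff_measure sym_matrices ?d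
      {C \<in> rel_frontier (psd_null x). strict_complementarity (- C)} = 0"
    by (rule hausdorff_measure_0_subset)
  \<comment> \<open>A codimension 2 subspace of \<open>sym_null x\<close> exists because there is a
    third direction orthogonal to \<open>x\<close> and \<open>e\<close>; the hyperplane loses at
    most one dimension and stays nontrivial.\<close>
  have "dim (sym_null_hyperplane x) > 0"
  proof -
    have "dim {x, e} \<le> card {x, e}" by (rule dim_le_card') simp
    also have "\<dots> \<le> 2" by (simp add: card_insert_if)
    also have "\<dots> < DIM(real^'n)" using assms(1) by simp
    finally obtain a where a: "a \<noteq> 0" "\<And>y. y \<in> span {x, e} \<Longrightarrow> orthogonal a y"
      using orthogonal_to_subspace_exists by blast
    then have "dim (pinned x (a /\<^sub>R norm a) e) + 2 \<le> dim (sym_null x)"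
      using e by (intro dim_pinned) (auto simp: orthogonal_def span_base)
    then show ?thesis using dim_sym_null_le[OF x0] by linarith
  qed
  then have "?d \<le> hausdorff_dim sym_matrices (rel_frontier (psd_null x))"
    by (rule hausdorff_dim_rel_frontier_psd_null[OF n x0])
  \<comment> \<open>Measure 0 at exponent \<open>?d\<close> passes to the Hausdorff dimension of the
    frontier, which is at least \<open>?d\<close>.\<close>
  then show ?thesis
    using hausdorff_measure_0_mono[OF null]
    by (simp add: fails_generically_def holds_generically_def Xbar psd_inter_trace_perp_outer)
qed

end
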